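(* Let $(p(x,y):x,y\in V)$ be transient. Then for $0<\rho<1$, the measure $\mu_{\rho,0}=\lim_{t\to\infty}\nu_\rho S_0(t)$ is not a product measure.
   Context: $V$ is a countable set with a distinguished vertex $0\in V$ (the origin). $(p(x,y))_{x,y\in V}$ are irreducible symmetric random walk rates: $p(x,y)=p(y,x)\ge 0$, for all $x,y$ there is $n$ with $p^{(n)}(x,y)>0$ where $p^{(n)}(x,y)=\sum_{z_1,\dots,z_{n-1}}p(x,z_1)\cdots p(z_{n-1},y)$, and $\sup_x\sum_y p(x,y)<\infty$. "Transient" means the continuous-time random walk on $V$ with generator $L_{\mathrm{RW}}f(x)=\sum_y p(x,y)(f(y)-f(x))$ is transient. $\Omega=\{0,1\}^V$. $S_0(t)$ is the semigroup of the symmetric exclusion process with source at $0$ of intensity $\lambda\ge0$, whose generator on local functions (depending on finitely many coordinates) is $$L_{\mathrm{SEP},0}f(\eta)=\sum_{x,y\in V}p(x,y)\eta_x(1-\eta_y)(f(\eta^{x,y})-f(\eta))+\lambda(1-\eta_0)(f(\eta^0)-f(\eta)),$$ where, for $\eta_x=1,\eta_y=0$, $\eta^{x,y}$ is $\eta$ with the particle at $x$ moved to $y$ ($\eta^{x,y}=\eta$ otherwise), and $\eta^0$ is $\eta$ with the occupation at $0$ flipped. $\nu_\rho$ is the Bernoulli product measure on $\Omega$ with density $\rho$, i.e. $\nu_\rho(\eta_x=1)=\rho$ for all $x\in V$. The limit defining $\mu_{\rho,0}$ is a weak limit. "Product measure" means a product over $x\in V$ of probability measures on $\{0,1\}$.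
   Formalization: The source intensity λ is assumed strictly positive; for λ = 0 the Bernoulli measure ν_ρ is invariant, so the limit is ν_ρ itself, a product measure, and the claim fails. *)

theory Defs
  imports "HOL-Probability.Probability"
begin

section \<open>Random walk rates and the random walk\<close>

text \<open>\<open>n_step p n x y\<close> is $p^{(n)}(x,y)$. For bounded rates all the sums involved converge.\<close>

primrec n_step :: "('v \<Rightarrow> 'v \<Rightarrow> real) \<Rightarrow> nat \<Rightarrow> 'v \<Rightarrow> 'v \<Rightarrow> real" where
  "n_step p 0 x y = of_bool (x = y)"
| "n_step p (Suc n) x y = (\<Sum>\<^sub>\<infinity>z. p x z * n_step p n z y)"

text \<open>Summability of the rows is stated separately because \<open>infsum\<close> of a divergent family is 0.\<close>

definition irreducible_symmetric_rates :: "('v \<Rightarrow> 'v \<Rightarrow> real) \<Rightarrow> bool" where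
  "irreducible_symmetric_rates p \<longleftrightarrow>
     (\<forall>x y. 0 \<le> p x y) \<and>
     (\<forall>x y. p x y = p y x) \<and>
     (\<forall>x y. \<exists>n\<ge>1. 0 < n_step p n x y) \<and>
     (\<forall>x. p x summable_on UNIV) \<and>
     bdd_above (range (\<lambda>x. \<Sum>\<^sub>\<infinity>y. p x y))"

definition rw_generator :: "('v \<Rightarrow> 'v \<Rightarrow> real) \<Rightarrow> ('v \<Rightarrow> real) \<Rightarrow> 'v \<Rightarrow> real" where
  "rw_generator p f x = (\<Sum>\<^sub>\<infinity>y. p x y * (f y - f x))"

text \<open>
  The continuous-time random walk is given as a family of laws \<open>P x\<close> (the walk started at \<open>x\<close>)
  and a process \<open>X\<close> with right-continuous paths in the discrete space \<open>'v\<close>. The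
  finite-dimensional distributions express the time-homogeneous Markov property. As the rates are
  bounded, the generator is a bounded operator on the bounded functions with the supremum norm.
\<close>

definition random_walk ::
  "('v \<Rightarrow> 'v \<Rightarrow> real) \<Rightarrow> ('v \<Rightarrow> 'w measure) \<Rightarrow> (real \<Rightarrow> 'w \<Rightarrow> 'v) \<Rightarrow> bool" where
  "random_walk p P X \<longleftrightarrow>
     (\<forall>x. prob_space (P x)) \<and>
     (\<forall>x. \<forall>t\<ge>0. X t \<in> P x \<rightarrow>\<^sub>M count_space UNIV) \<and>
     (\<forall>x. \<forall>\<omega>\<in>space (P x). \<forall>t\<ge>0. \<forall>\<^sub>F s in at_right t. X s \<omega> = X t \<omega>) \<and>
     (\<forall>x. AE \<omega> in P x. X 0 \<omega> = x) \<and>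
     (\<forall>x n ts ys. ts 0 = 0 \<and> ys 0 = x \<and> (\<forall>i<n. ts i < ts (Suc i)) \<longrightarrow>
        measure (P x) {\<omega> \<in> space (P x). \<forall>i\<le>n. X (ts i) \<omega> = ys i} =
        (\<Prod>i<n. measure (P (ys i))
                  {\<omega> \<in> space (P (ys i)). X (ts (Suc i) - ts i) \<omega> = ys (Suc i)})) \<and>
     (\<forall>f. bounded (range f) \<longrightarrow>
        uniform_limit UNIV (\<lambda>t x. ((\<integral>\<omega>. f (X t \<omega>) \<partial>P x) - f x) / t) (rw_generator p f)
          (at_right 0))"

text \<open>Every state is almost surely left for good: its set of visiting times is bounded.\<close>

definition transient_walk :: "('v \<Rightarrow> 'w measure) \<Rightarrow> (real \<Rightarrow> 'w \<Rightarrow> 'v) \<Rightarrow> bool" where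
  "transient_walk P X \<longleftrightarrow> (\<forall>x. AE \<omega> in P x. bounded {t. 0 \<le> t \<and> X t \<omega> = x})"


section \<open>Configurations and the exclusion process with a source\<close>

text \<open>
  A configuration is a function \<open>'v \<Rightarrow> bool\<close>, where \<open>True\<close> stands for 1 (occupied). It carries
  the product topology and the product \<open>\<sigma>\<close>-algebra; for countable \<open>'v\<close> the latter
  is the Borel \<open>\<sigma>\<close>-algebra of the former.
\<close>

definition config_space :: "('v \<Rightarrow> bool) measure" where
  "config_space = Pi\<^sub>M UNIV (\<lambda>_. count_space UNIV)"

definition local_function :: "(('v \<Rightarrow> bool) \<Rightarrow> real) \<Rightarrow> bool" where
  "local_function f \<longleftrightarrow> (\<exists>A. finite A \<and> (\<forall>\<eta> \<zeta>. (\<forall>x\<in>A. \<eta> x = \<zeta> x) \<longrightarrow> f \<eta> = f \<zeta>))"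

definition move_particle :: "'v \<Rightarrow> 'v \<Rightarrow> ('v \<Rightarrow> bool) \<Rightarrow> 'v \<Rightarrow> bool" where
  "move_particle x y \<eta> = (if \<eta> x \<and> \<not> \<eta> y then \<eta>(x := False, y := True) else \<eta>)"

definition flip_at :: "'v \<Rightarrow> ('v \<Rightarrow> bool) \<Rightarrow> 'v \<Rightarrow> bool" where
  "flip_at x \<eta> = \<eta>(x := \<not> \<eta> x)"

text \<open>
  The double sum converges absolutely for local \<open>f\<close>, since only pairs \<open>(x, y)\<close> meeting
  the finite support of \<open>f\<close> contribute.
\<close>

definition sep_source_generator ::
  "('v \<Rightarrow> 'v \<Rightarrow> real) \<Rightarrow> real \<Rightarrow> 'v \<Rightarrow> (('v \<Rightarrow> bool) \<Rightarrow> real) \<Rightarrow> ('v \<Rightarrow> bool) \<Rightarrow> real" where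
  "sep_source_generator p lam v0 f \<eta> =
     (\<Sum>\<^sub>\<infinity>(x, y). p x y * of_bool (\<eta> x) * (1 - of_bool (\<eta> y)) * (f (move_particle x y \<eta>) - f \<eta>))
     + lam * (1 - of_bool (\<eta> v0)) * (f (flip_at v0 \<eta>) - f \<eta>)"

text \<open>
  A Feller semigroup \<open>S(t)\<close> on the continuous functions is represented by its transition
  probabilities: \<open>S(t) f \<eta> = (\<integral>\<zeta>. f \<zeta> \<partial>K t \<eta>)\<close> for functions, and \<open>\<nu> S(t) = \<nu> \<bind> K t\<close>
  for measures.
\<close>

definition feller_semigroup :: "(real \<Rightarrow> ('v \<Rightarrow> bool) \<Rightarrow> ('v \<Rightarrow> bool) measure) \<Rightarrow> bool" where
  "feller_semigroup K \<longleftrightarrow>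
     (\<forall>t\<ge>0. K t \<in> config_space \<rightarrow>\<^sub>M prob_algebra config_space) \<and>
     (\<forall>\<eta>. K 0 \<eta> = return config_space \<eta>) \<and>
     (\<forall>s\<ge>0. \<forall>t\<ge>0. \<forall>\<eta>. K (s + t) \<eta> = K s \<eta> \<bind> K t) \<and>
     (\<forall>f :: ('v \<Rightarrow> bool) \<Rightarrow> real. continuous_on UNIV f \<longrightarrow>
        (\<forall>t\<ge>0. continuous_on UNIV (\<lambda>\<eta>. \<integral>\<zeta>. f \<zeta> \<partial>K t \<eta>)) \<and>
        uniform_limit UNIV (\<lambda>t \<eta>. \<integral>\<zeta>. f \<zeta> \<partial>K t \<eta>) f (at_right 0))"

text \<open>
  For bounded rates the local functions are a core for the generator of the exclusion process, so
  prescribing the generator on local functions determines the semigroup.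
\<close>

definition sep_source_semigroup ::
  "('v \<Rightarrow> 'v \<Rightarrow> real) \<Rightarrow> real \<Rightarrow> 'v \<Rightarrow> (real \<Rightarrow> ('v \<Rightarrow> bool) \<Rightarrow> ('v \<Rightarrow> bool) measure) \<Rightarrow> bool" where
  "sep_source_semigroup p lam v0 K \<longleftrightarrow>
     feller_semigroup K \<and>
     (\<forall>f. local_function f \<longrightarrow>
        uniform_limit UNIV (\<lambda>t \<eta>. ((\<integral>\<zeta>. f \<zeta> \<partial>K t \<eta>) - f \<eta>) / t)
          (sep_source_generator p lam v0 f) (at_right 0))"


section \<open>Measures on configurations\<close>

definition bernoulli_product :: "real \<Rightarrow> ('v \<Rightarrow> bool) measure" where
  "bernoulli_product \<rho> = Pi\<^sub>M UNIV (\<lambda>_. measure_pmf (bernoulli_pmf \<rho>))"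

definition is_product_measure :: "('v \<Rightarrow> bool) measure \<Rightarrow> bool" where
  "is_product_measure \<mu> \<longleftrightarrow> (\<exists>q :: 'v \<Rightarrow> bool pmf. \<mu> = Pi\<^sub>M UNIV (\<lambda>x. measure_pmf (q x)))"

text \<open>Continuous functions on the compact space of configurations are automatically bounded.\<close>

definition weak_limit ::
  "(real \<Rightarrow> ('v \<Rightarrow> bool) measure) \<Rightarrow> ('v \<Rightarrow> bool) measure \<Rightarrow> bool" where
  "weak_limit m \<mu> \<longleftrightarrow>
     prob_space \<mu> \<and> sets \<mu> = sets config_space \<and>
     (\<forall>f :: ('v \<Rightarrow> bool) \<Rightarrow> real. continuous_on UNIV f \<longrightarrow>
        ((\<lambda>t. \<integral>\<eta>. f \<eta> \<partial>m t) \<longlongrightarrow> (\<integral>\<eta>. f \<eta> \<partial>\<mu>)) at_top)"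

end

theory Submission
  imports Defs
begin

text \<open>
The proof follows the holes instead of the particles. For a finite set \<open>A\<close> of sites let
\<open>vacant A\<close> be the indicator that \<open>A\<close> contains no particle. Applied to \<open>vacant A\<close>, the generator of
the exclusion process with a source at \<open>v0\<close> produces a combination of functions \<open>vacant B\<close> with \<open>B\<close>
of the same size (\<open>generator_vacant\<close>): each point of \<open>A\<close> performs the random walk, subject to
exclusion, and the source kills at rate \<open>lam\<close> while \<open>v0 \<in> A\<close>. Hence the hole probabilities
\<open>w t A\<close> of the process started from \<open>\<nu>\<close> solve a closed linear equation \<open>w' = Q w\<close> on the sets of each
fixed size. There \<open>Q\<close> is bounded with nonnegative off-diagonal rates, so that sub- and supersolutions
can be compared (\<open>comparison_principle\<close>, \<open>hole_comparison\<close>).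

Existence of the limit: for a Bernoulli start the constant \<open>(1 - \<rho>) ^ card A\<close> is a supersolution with
the initial value of \<open>w\<close>, and by the Markov property and comparison \<open>w t A\<close> decreases in \<open>t\<close>. So all hole
probabilities converge. By inclusion and exclusion the integrals of all local functions converge, and
compactness of the space of configurations turns the limits into a probability measure \<open>\<mu>\<close>
(\<open>weak_limit_if_local_integrals_converge\<close>). As a weak limit, \<open>\<mu>\<close> is stationary, so its hole
probabilities \<open>W\<close> satisfy \<open>Q W = 0\<close>.

Suppose that \<open>\<mu>\<close> were a product measure, and put \<open>g x = W {x}\<close>. Comparing the three equations \<open>Q W = 0\<close>
at \<open>{x}\<close>, \<open>{y}\<close> and \<open>{x, y}\<close>, everything cancels except the exclusion term \<open>p x y * (g x - g y)\<^sup>2\<close>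
(\<open>product_pair_identity\<close>). It must vanish, so by irreducibility \<open>g\<close> is constant, and the equation at
\<open>{v0}\<close> becomes \<open>lam * g v0 = 0\<close>.

But transience forces \<open>g v0 > 0\<close>. The probability \<open>h x\<close> that the walk started at \<open>x\<close> ever visits \<open>v0\<close>
is excessive, equals 1 at \<open>v0\<close>, and is not identically 1 (\<open>transient_excessive_function\<close>); therefore
\<open>(1 - \<rho>) * (1 - h x)\<close> is a subsolution of the equation on singletons, and \<open>g\<close> lies above it. So \<open>g\<close> is not
identically 0, whereas \<open>g v0 = 0\<close> would make \<open>g\<close> harmonic at every point where it vanishes, and the zero
would spread over the whole space by irreducibility.
\<close>

section \<open>Local functions and weak limits of configuration measures\<close>

lemma space_config [simp]: "space config_space = UNIV"
  by (simp add: config_space_def space_PiM)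

lemma coordinate_measurable: "(\<lambda>\<eta>. \<eta> x) \<in> config_space \<rightarrow>\<^sub>M count_space UNIV"
  unfolding config_space_def by (rule measurable_component_singleton) simp

text \<open>
Only the summand with \<open>C = {x \<in> A. \<eta> x}\<close> is nonzero. Measurability, continuity and convergence of
integrals of local functions all reduce to cylinder indicators by this formula.
\<close>

lemma local_function_expansion:
  assumes "finite A" and "\<And>\<eta> \<zeta>. (\<forall>x\<in>A. \<eta> x = \<zeta> x) \<Longrightarrow> f \<eta> = f \<zeta>"
  shows "f \<eta> = (\<Sum>C\<in>Pow A. f (\<lambda>x. x \<in> C) * (\<Prod>x\<in>A. of_bool (\<eta> x = (x \<in> C)) :: real))"
proof -
  let ?C = "{x\<in>A. \<eta> x}"
  have "(\<Prod>x\<in>A. of_bool (\<eta> x = (x \<in> C)) :: real) = 0" if "C \<in> Pow A - {?C}" for C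
    using assms(1) that by (subst prod_zero_iff) auto
  then have "(\<Sum>C\<in>Pow A. f (\<lambda>x. x \<in> C) * (\<Prod>x\<in>A. of_bool (\<eta> x = (x \<in> C)) :: real)) =
      (\<Sum>C\<in>{?C}. f (\<lambda>x. x \<in> C) * (\<Prod>x\<in>A. of_bool (\<eta> x = (x \<in> C)) :: real))"
    using assms(1) by (intro sum.mono_neutral_right) auto
  also have "\<dots> = f (\<lambda>x. x \<in> ?C)"
    by simp
  also have "\<dots> = f \<eta>"
    by (rule assms(2)) simp
  finally show ?thesis ..
qed

lemma local_functionE:
  assumes "local_function f"
  obtains A where "finite A" "\<And>\<eta> \<zeta>. (\<forall>x\<in>A. \<eta> x = \<zeta> x) \<Longrightarrow> f \<eta> = f \<zeta>"
    "f = (\<lambda>\<eta>. \<Sum>C\<in>Pow A. f (\<lambda>x. x \<in> C) * (\<Prod>x\<in>A. of_bool (\<eta> x = (x \<in> C)) :: real))"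
proof -
  obtain A where A: "finite A" "\<And>\<eta> \<zeta>. (\<forall>x\<in>A. \<eta> x = \<zeta> x) \<Longrightarrow> f \<eta> = f \<zeta>"
    using assms unfolding local_function_def by blast
  show thesis by (rule that[OF A], assumption, rule ext, rule local_function_expansion[OF A])
qed

lemma local_function_measurable:
  assumes "local_function f"
  shows "f \<in> borel_measurable config_space"
proof -
  from assms obtain A where A: "finite A"
    "f = (\<lambda>\<eta>. \<Sum>C\<in>Pow A. f (\<lambda>x. x \<in> C) * (\<Prod>x\<in>A. of_bool (\<eta> x = (x \<in> C)) :: real))"
    by (rule local_functionE)
  have *: "(\<lambda>\<eta>. of_bool (\<eta> x = b) :: real) \<in> borel_measurable config_space" for x :: 'a and b
    using coordinate_measurable by (rule measurable_compose) simp
  show ?thesis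
    by (subst A(2)) (intro borel_measurable_sum borel_measurable_times borel_measurable_prod
      borel_measurable_const *)
qed

lemma local_function_continuous:
  assumes "local_function f"
  shows "continuous_on UNIV f"
proof -
  from assms obtain A where A: "finite A"
    "f = (\<lambda>\<eta>. \<Sum>C\<in>Pow A. f (\<lambda>x. x \<in> C) * (\<Prod>x\<in>A. of_bool (\<eta> x = (x \<in> C)) :: real))"
    by (rule local_functionE)
  have *: "continuous_on UNIV (\<lambda>\<eta> :: 'a \<Rightarrow> bool. of_bool (\<eta> x = b) :: real)" for x b
  proof -
    have "continuous_on UNIV (\<lambda>c. of_bool (c = b) :: real)"
      by (simp add: continuous_on_open_vimage open_discrete)
    then show ?thesis
      by (rule continuous_on_compose2) (auto intro: continuous_on_product_coordinates)
  qed
  show ?thesis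
    by (subst A(2)) (intro continuous_on_sum continuous_on_mult continuous_on_prod continuous_on_const *)
qed

lemma local_function_combine:
  assumes "local_function f" "local_function g"
  shows "local_function (\<lambda>\<eta>. H (f \<eta>) (g \<eta>))"
proof -
  obtain A where A: "finite A" "\<And>\<eta> \<zeta>. (\<forall>x\<in>A. \<eta> x = \<zeta> x) \<Longrightarrow> f \<eta> = f \<zeta>"
    using assms(1) unfolding local_function_def by blast
  obtain B where B: "finite B" "\<And>\<eta> \<zeta>. (\<forall>x\<in>B. \<eta> x = \<zeta> x) \<Longrightarrow> g \<eta> = g \<zeta>"
    using assms(2) unfolding local_function_def by blast
  have "H (f \<eta>) (g \<eta>) = H (f \<zeta>) (g \<zeta>)" if "\<forall>x\<in>A \<union> B. \<eta> x = \<zeta> x" for \<eta> \<zeta>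
    using A(2)[of \<eta> \<zeta>] B(2)[of \<eta> \<zeta>] that by simp
  then show ?thesis
    unfolding local_function_def using A(1) B(1) by (intro exI[of _ "A \<union> B"]) simp
qed

lemma compact_configurations: "compact (UNIV :: ('v \<Rightarrow> bool) set)"
proof -
  have "compact_space (euclidean :: bool topology)"
    by (simp add: compact_space_def finite_imp_compact)
  then have "compact_space (product_topology (\<lambda>_::'v. euclidean :: bool topology) UNIV)"
    by (simp add: compact_space_product_topology)
  then show ?thesis
    by (simp add: euclidean_product_topology compact_space_def)
qed

text \<open>
Every configuration has a neighbourhood, determined by finitely many coordinates, on which \<open>f\<close>
oscillates by less than \<open>e\<close>. By compactness finitely many of them suffice, and emptying a configuration
outside the coordinates that they use does not leave the neighbourhood.
\<close>

lemma continuous_approx_local: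
  fixes f :: "('v \<Rightarrow> bool) \<Rightarrow> real"
  assumes f: "continuous_on UNIV f" and e: "0 < e"
  shows "\<exists>g. local_function g \<and> (\<forall>\<eta>. \<bar>f \<eta> - g \<eta>\<bar> \<le> e)"
proof -
  have nbhd: "\<exists>U A. open U \<and> \<eta> \<in> U \<and> finite A \<and> (\<forall>\<zeta>\<in>U. \<bar>f \<zeta> - f \<eta>\<bar> < e / 2) \<and>
      (\<forall>\<zeta> \<xi>. \<zeta> \<in> U \<longrightarrow> (\<forall>x\<in>A. \<zeta> x = \<xi> x) \<longrightarrow> \<xi> \<in> U)" for \<eta>
  proof -
    have "open (f -` ball (f \<eta>) (e / 2))"
      using f by (simp add: continuous_on_open_vimage)
    then have "openin (product_topology (\<lambda>_. euclidean) UNIV) (f -` ball (f \<eta>) (e / 2))"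
      by (subst euclidean_product_topology) simp
    moreover have "\<eta> \<in> f -` ball (f \<eta>) (e / 2)" using e by simp
    ultimately obtain U where U: "finite {i. U i \<noteq> UNIV}" "\<And>i. open (U i)"
        "\<eta> \<in> Pi\<^sub>E UNIV U" "Pi\<^sub>E UNIV U \<subseteq> f -` ball (f \<eta>) (e / 2)"
      unfolding openin_product_topology_alt by (auto dest!: bspec)
    show ?thesis
    proof (intro exI conjI)
      show "open (Pi\<^sub>E UNIV U)" using U(1,2) by (intro open_PiE) auto
      show "\<forall>\<zeta>\<in>Pi\<^sub>E UNIV U. \<bar>f \<zeta> - f \<eta>\<bar> < e / 2"
        using U(4) by (force simp: dist_real_def abs_minus_commute)
      show "\<forall>\<zeta> \<xi>. \<zeta> \<in> Pi\<^sub>E UNIV U \<longrightarrow> (\<forall>x\<in>{i. U i \<noteq> UNIV}. \<zeta> x = \<xi> x) \<longrightarrow> \<xi> \<in> Pi\<^sub>E UNIV U"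
      proof (intro allI impI)
        fix \<zeta> \<xi> assume *: "\<zeta> \<in> Pi\<^sub>E UNIV U" "\<forall>x\<in>{i. U i \<noteq> UNIV}. \<zeta> x = \<xi> x"
        have "\<xi> i \<in> U i" for i
        proof (cases "U i = UNIV")
          case False
          with *(2) have "\<xi> i = \<zeta> i" by simp
          with *(1) show ?thesis by (simp add: PiE_iff)
        qed simp
        then show "\<xi> \<in> Pi\<^sub>E UNIV U" by (simp add: PiE_iff)
      qed
    qed (use U in auto)
  qed
  obtain U A where UA: "\<And>\<eta>. open (U \<eta>)" "\<And>\<eta>. \<eta> \<in> U \<eta>" "\<And>\<eta>. finite (A \<eta>)"
      "\<And>\<eta> \<zeta>. \<zeta> \<in> U \<eta> \<Longrightarrow> \<bar>f \<zeta> - f \<eta>\<bar> < e / 2"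
      "\<And>\<eta> \<zeta> \<xi>. \<zeta> \<in> U \<eta> \<Longrightarrow> (\<forall>x\<in>A \<eta>. \<zeta> x = \<xi> x) \<Longrightarrow> \<xi> \<in> U \<eta>"
    using nbhd by metis
  obtain T where T: "finite T" "UNIV \<subseteq> (\<Union>\<eta>\<in>T. U \<eta>)"
  proof (rule compactE_image[OF compact_configurations])
    show "open (U \<eta>)" for \<eta> by (rule UA(1))
    show "UNIV \<subseteq> (\<Union>\<eta>\<in>UNIV. U \<eta>)" using UA(2) by (auto intro: UN_I)
  qed
  define B where "B = (\<Union>\<eta>\<in>T. A \<eta>)"
  \<comment> \<open>\<open>g \<zeta>\<close> evaluates \<open>f\<close> at the configuration \<open>\<zeta>\<close> emptied outside \<open>B\<close>\<close>
  define g where "g \<zeta> = f (\<lambda>x. x \<in> B \<and> \<zeta> x)" for \<zeta>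
  have "local_function g"
  proof -
    have "g \<eta> = g \<zeta>" if "\<forall>x\<in>B. \<eta> x = \<zeta> x" for \<eta> \<zeta>
      unfolding g_def using that by (intro arg_cong[of _ _ f]) auto
    moreover have "finite B" using T(1) UA(3) by (simp add: B_def)
    ultimately show ?thesis unfolding local_function_def by blast
  qed
  moreover have "\<bar>f \<zeta> - g \<zeta>\<bar> \<le> e" for \<zeta>
  proof -
    obtain \<eta> where \<eta>: "\<eta> \<in> T" "\<zeta> \<in> U \<eta>" using T(2) by blast
    then have "(\<lambda>x. x \<in> B \<and> \<zeta> x) \<in> U \<eta>"
      by (intro UA(5)[OF \<eta>(2)]) (auto simp: B_def)
    from UA(4)[OF this] UA(4)[OF \<eta>(2)] show ?thesis unfolding g_def by linarith
  qed
  ultimately show ?thesis by blast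
qed

lemma continuous_config_bounded:
  fixes f :: "('v \<Rightarrow> bool) \<Rightarrow> real"
  assumes "continuous_on UNIV f"
  obtains B where "\<And>\<eta>. \<bar>f \<eta>\<bar> \<le> B"
  using compact_imp_bounded[OF compact_continuous_image[OF assms compact_configurations]]
  unfolding bounded_iff by auto

lemma continuous_config_measurable:
  fixes f :: "('v \<Rightarrow> bool) \<Rightarrow> real"
  assumes "continuous_on UNIV f"
  shows "f \<in> borel_measurable config_space"
proof -
  obtain g where g: "\<And>n. local_function (g n)" "\<And>n \<eta>. \<bar>f \<eta> - g n \<eta>\<bar> \<le> inverse (real (Suc n))"
    using continuous_approx_local[OF assms, of "inverse (real (Suc _))"] by (metis inverse_positive_iff_positive of_nat_0_less_iff zero_less_Suc)
  show ?thesis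
  proof (rule borel_measurable_LIMSEQ_real)
    show "g n \<in> borel_measurable config_space" for n
      by (rule local_function_measurable[OF g(1)])
    show "(\<lambda>n. g n \<eta>) \<longlonglongrightarrow> f \<eta>" for \<eta>
    proof (rule LIMSEQ_I)
      fix r :: real assume "0 < r"
      then obtain n0 where n0: "inverse (real (Suc n0)) < r" using reals_Archimedean by blast
      have "\<bar>g n \<eta> - f \<eta>\<bar> < r" if "n0 \<le> n" for n
      proof -
        have "inverse (real (Suc n)) \<le> inverse (real (Suc n0))" using that by (simp add: field_simps)
        with g(2)[of \<eta> n] n0 show ?thesis by linarith
      qed
      then show "\<exists>n0. \<forall>n\<ge>n0. norm (g n \<eta> - f \<eta>) < r" by auto
    qed
  qed
qed

definition vacant :: "'v set \<Rightarrow> ('v \<Rightarrow> bool) \<Rightarrow> real" where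
  "vacant A \<eta> = of_bool (\<forall>x\<in>A. \<not> \<eta> x)"

lemma vacant_bounds: "0 \<le> vacant A \<eta>" "vacant A \<eta> \<le> 1" "\<bar>vacant A \<eta>\<bar> \<le> 1"
  by (auto simp: vacant_def)

lemma vacant_local: "finite A \<Longrightarrow> local_function (vacant A)"
  unfolding local_function_def vacant_def by (intro exI[of _ A]) auto

lemma integrable_config:
  fixes f :: "('v \<Rightarrow> bool) \<Rightarrow> real"
  assumes "prob_space m" "sets m = sets config_space"
    and f: "f \<in> borel_measurable config_space" and B: "\<And>\<eta>. \<bar>f \<eta>\<bar> \<le> B"
  shows "integrable m f"
proof -
  interpret prob_space m by fact
  have "f \<in> borel_measurable m" using f measurable_cong_sets[OF assms(2) refl] by blast
  then show ?thesis using B by (intro integrable_const_bound[where B = B]) auto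
qed

lemma integrable_continuous_config:
  fixes f :: "('v \<Rightarrow> bool) \<Rightarrow> real"
  assumes "prob_space m" "sets m = sets config_space" and f: "continuous_on UNIV f"
  shows "integrable m f"
proof -
  from f obtain B where "\<And>\<eta>. \<bar>f \<eta>\<bar> \<le> B" by (rule continuous_config_bounded) blast
  then show ?thesis
    by (rule integrable_config[OF assms(1,2) continuous_config_measurable[OF f]])
qed

lemma integral_uniform_close:
  fixes f g :: "('v \<Rightarrow> bool) \<Rightarrow> real"
  assumes n: "prob_space n" "sets n = sets config_space"
    and f: "continuous_on UNIV f" and g: "continuous_on UNIV g" and e: "\<And>\<eta>. \<bar>f \<eta> - g \<eta>\<bar> \<le> e"
  shows "\<bar>(\<integral>\<eta>. f \<eta> \<partial>n) - (\<integral>\<eta>. g \<eta> \<partial>n)\<bar> \<le> e"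
proof -
  interpret prob_space n by fact
  have i: "integrable n f" "integrable n g"
    by (rule integrable_continuous_config[OF n f], rule integrable_continuous_config[OF n g])
  have "(\<integral>\<eta>. f \<eta> \<partial>n) - (\<integral>\<eta>. g \<eta> \<partial>n) = (\<integral>\<eta>. f \<eta> - g \<eta> \<partial>n)" using i by simp
  also have "\<bar>\<dots>\<bar> \<le> (\<integral>\<eta>. \<bar>f \<eta> - g \<eta>\<bar> \<partial>n)" by (rule integral_abs_bound)
  also have "\<dots> \<le> (\<integral>\<eta>. e \<partial>n)" using i e by (intro integral_mono) auto
  finally show ?thesis by (simp add: prob_space)
qed

lemma uniform_limit_integral:
  fixes f :: "'i \<Rightarrow> ('v \<Rightarrow> bool) \<Rightarrow> real"
  assumes m: "prob_space m" "sets m = sets config_space"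
    and lim: "uniform_limit UNIV f g F" and f: "\<And>i. continuous_on UNIV (f i)" and F: "F \<noteq> bot"
  shows "((\<lambda>i. \<integral>\<eta>. f i \<eta> \<partial>m) \<longlongrightarrow> (\<integral>\<eta>. g \<eta> \<partial>m)) F"
proof (rule tendstoI)
  fix e :: real assume e: "0 < e"
  have g: "continuous_on UNIV g"
    by (rule uniform_limit_theorem[OF always_eventually lim F]) (use f in simp)
  have "\<forall>\<^sub>F i in F. \<forall>\<eta>\<in>UNIV. dist (f i \<eta>) (g \<eta>) < e / 2"
    using uniform_limitD[OF lim, of "e / 2"] e by simp
  then show "\<forall>\<^sub>F i in F. dist (\<integral>\<eta>. f i \<eta> \<partial>m) (\<integral>\<eta>. g \<eta> \<partial>m) < e"
  proof eventually_elim
    case (elim i)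
    then have "\<bar>(\<integral>\<eta>. f i \<eta> \<partial>m) - (\<integral>\<eta>. g \<eta> \<partial>m)\<bar> \<le> e / 2"
      by (intro integral_uniform_close[OF m f g]) (simp add: dist_real_def less_imp_le)
    with e show ?case by (simp add: dist_real_def)
  qed
qed

text \<open>
Inclusion and exclusion: the indicator that \<open>B\<close> is vacant and \<open>C\<close> is occupied is obtained from the
functions \<open>vacant\<close> by removing the points of \<open>C\<close> one at a time.
\<close>

lemma integral_local_converges:
  fixes m :: "'t \<Rightarrow> ('v \<Rightarrow> bool) measure"
  assumes m: "\<forall>\<^sub>F t in F. prob_space (m t) \<and> sets (m t) = sets config_space"
    and conv: "\<And>A. finite A \<Longrightarrow> \<exists>l. ((\<lambda>t. \<integral>\<eta>. vacant A \<eta> \<partial>m t) \<longlongrightarrow> l) F"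
    and f: "local_function f"
  shows "\<exists>l. ((\<lambda>t. \<integral>\<eta>. f \<eta> \<partial>m t) \<longlongrightarrow> l) F"
proof -
  have loc: "local_function (\<lambda>\<eta>. vacant B \<eta> * (\<Prod>x\<in>C. of_bool (\<eta> x)))"
    if "finite B" "finite C" for B C :: "'v set"
    unfolding local_function_def vacant_def using that
    by (intro exI[of _ "B \<union> C"]) auto
  have int: "\<forall>\<^sub>F t in F. integrable (m t) g" if "local_function g" for g
    using m by eventually_elim (use that local_function_continuous integrable_continuous_config in blast)
  have cyl: "\<exists>l. ((\<lambda>t. \<integral>\<eta>. vacant B \<eta> * (\<Prod>x\<in>C. of_bool (\<eta> x)) \<partial>m t) \<longlongrightarrow> l) F"
    if "finite C" "finite B" for B C
    using that
  proof (induction C arbitrary: B rule: finite_induct)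
    case empty
    then show ?case using conv[of B] by simp
  next
    case (insert c C)
    let ?f = "\<lambda>B \<eta>. vacant B \<eta> * (\<Prod>x\<in>C. of_bool (\<eta> x))"
    obtain l l' where l: "((\<lambda>t. \<integral>\<eta>. ?f B \<eta> \<partial>m t) \<longlongrightarrow> l) F"
        "((\<lambda>t. \<integral>\<eta>. ?f (insert c B) \<eta> \<partial>m t) \<longlongrightarrow> l') F"
      using insert.IH[of B] insert.IH[of "insert c B"] insert.prems by auto
    have split: "vacant B \<eta> * (\<Prod>x\<in>insert c C. of_bool (\<eta> x)) = ?f B \<eta> - ?f (insert c B) \<eta>" for \<eta>
      using insert.hyps by (auto simp: vacant_def)
    have "\<forall>\<^sub>F t in F. (\<integral>\<eta>. ?f B \<eta> \<partial>m t) - (\<integral>\<eta>. ?f (insert c B) \<eta> \<partial>m t) =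
        (\<integral>\<eta>. vacant B \<eta> * (\<Prod>x\<in>insert c C. of_bool (\<eta> x)) \<partial>m t)"
    proof -
      have "\<forall>\<^sub>F t in F. integrable (m t) (?f B)" "\<forall>\<^sub>F t in F. integrable (m t) (?f (insert c B))"
        using int[OF loc] insert.hyps(1) insert.prems by auto
      then show ?thesis
        unfolding split by eventually_elim (rule Bochner_Integration.integral_diff[symmetric])
    qed
    with tendsto_diff[OF l] show ?case by (blast intro: Lim_transform_eventually)
  qed
  obtain A where A: "finite A"
    "f = (\<lambda>\<eta>. \<Sum>C\<in>Pow A. f (\<lambda>x. x \<in> C) * (\<Prod>x\<in>A. of_bool (\<eta> x = (x \<in> C)) :: real))"
    using f by (rule local_functionE)
  let ?g = "\<lambda>C \<eta>. vacant (A - C) \<eta> * (\<Prod>x\<in>C. of_bool (\<eta> x))"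
  have cyl_eq: "(\<Prod>x\<in>A. of_bool (\<eta> x = (x \<in> C)) :: real) = ?g C \<eta>" if "C \<in> Pow A" for C \<eta>
  proof -
    have "(\<Prod>x\<in>A. of_bool (\<eta> x = (x \<in> C)) :: real) =
        (\<Prod>x\<in>A - C. of_bool (\<eta> x = (x \<in> C))) * (\<Prod>x\<in>C. of_bool (\<eta> x = (x \<in> C)))"
      using that A(1) by (intro prod.subset_diff) auto
    also have "(\<Prod>x\<in>A - C. of_bool (\<eta> x = (x \<in> C)) :: real) = vacant (A - C) \<eta>"
      using A(1) by (auto simp: vacant_def prod_zero_iff)
    finally show ?thesis by simp
  qed
  have fin: "finite (A - C)" "finite C" if "C \<in> Pow A" for C
    using A(1) that finite_subset by auto
  have "\<forall>C\<in>Pow A. \<exists>l. ((\<lambda>t. \<integral>\<eta>. ?g C \<eta> \<partial>m t) \<longlongrightarrow> l) F"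
    by (intro ballI cyl fin)
  then obtain l where l: "\<And>C. C \<in> Pow A \<Longrightarrow> ((\<lambda>t. \<integral>\<eta>. ?g C \<eta> \<partial>m t) \<longlongrightarrow> l C) F"
    unfolding bchoice_iff by blast
  have "\<forall>\<^sub>F t in F. (\<Sum>C\<in>Pow A. f (\<lambda>x. x \<in> C) * (\<integral>\<eta>. ?g C \<eta> \<partial>m t)) = (\<integral>\<eta>. f \<eta> \<partial>m t)"
    using m
  proof eventually_elim
    case (elim t)
    have "integrable (m t) (?g C)" if "C \<in> Pow A" for C
      using elim local_function_continuous[OF loc[OF fin[OF that]]]
      by (intro integrable_continuous_config) auto
    then have "(\<Sum>C\<in>Pow A. f (\<lambda>x. x \<in> C) * (\<integral>\<eta>. ?g C \<eta> \<partial>m t)) =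
       (\<integral>\<eta>. (\<Sum>C\<in>Pow A. f (\<lambda>x. x \<in> C) * ?g C \<eta>) \<partial>m t)"
      by (subst Bochner_Integration.integral_sum) auto
    also have "(\<lambda>\<eta>. \<Sum>C\<in>Pow A. f (\<lambda>x. x \<in> C) * ?g C \<eta>) = f"
      by (subst (2) A(2)) (intro ext sum.cong refl, simp only: cyl_eq)
    finally show ?case .
  qed
  moreover have "((\<lambda>t. \<Sum>C\<in>Pow A. f (\<lambda>x. x \<in> C) * (\<integral>\<eta>. ?g C \<eta> \<partial>m t)) \<longlongrightarrow>
      (\<Sum>C\<in>Pow A. f (\<lambda>x. x \<in> C) * l C)) F"
    by (intro tendsto_intros l)
  ultimately show ?thesis by (blast intro: Lim_transform_eventually)
qed

text \<open>
The limits of the probabilities of cylinder sets form a finitely additive set function. Cylinder sets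
are closed and the space is compact, so a decreasing sequence of cylinder sets with empty intersection
is eventually empty; this is the continuity at the empty set which Caratheodory's extension theorem
asks for.
\<close>

lemma weak_limit_if_local_integrals_converge:
  fixes m :: "real \<Rightarrow> ('v \<Rightarrow> bool) measure"
  assumes m: "\<And>t. 0 \<le> t \<Longrightarrow> prob_space (m t)" "\<And>t. 0 \<le> t \<Longrightarrow> sets (m t) = sets config_space"
    and conv: "\<And>f. local_function f \<Longrightarrow> \<exists>l. ((\<lambda>t. \<integral>\<eta>. f \<eta> \<partial>m t) \<longlongrightarrow> l) at_top"
  shows "\<exists>\<mu>. weak_limit m \<mu>"
proof -
  have ev: "\<forall>\<^sub>F t in at_top. (0::real) \<le> t" by (rule eventually_ge_at_top)
  define M where "M = {A :: ('v \<Rightarrow> bool) set. local_function (indicator A)}"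
  have M_sets: "A \<in> sets config_space" if "A \<in> M" for A
    using local_function_measurable[of "indicator A"] that
    by (simp add: M_def borel_measurable_indicator_iff)
  have "\<forall>A\<in>M. \<exists>l. ((\<lambda>t. \<integral>\<eta>. indicator A \<eta> \<partial>m t) \<longlongrightarrow> (l::real)) at_top"
    using conv unfolding M_def by blast
  then obtain L :: "('v \<Rightarrow> bool) set \<Rightarrow> real"
    where L: "\<And>A. A \<in> M \<Longrightarrow> ((\<lambda>t. \<integral>\<eta>. indicator A \<eta> \<partial>m t) \<longlongrightarrow> L A) at_top"
    unfolding bchoice_iff by blast
  have L': "((\<lambda>t. measure (m t) A) \<longlongrightarrow> L A) at_top" if "A \<in> M" for A
  proof (rule Lim_transform_eventually[OF L[OF that]])
    show "\<forall>\<^sub>F t in at_top. (\<integral>\<eta>. indicator A \<eta> \<partial>m t) = measure (m t) A"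
      using ev by eventually_elim
        (use M_sets[OF that] m(2) in \<open>simp add: sets_eq_imp_space_eq[OF m(2)]\<close>)
  qed
  have Un: "A \<union> B \<in> M" if "A \<in> M" "B \<in> M" for A B
    using local_function_combine[of "indicator A" "indicator B" max] that
    by (auto simp: M_def indicator_def of_bool_def max_def elim!: back_subst[of local_function])
  have Compl: "- A \<in> M" if "A \<in> M" for A
    using local_function_combine[of "indicator A" "indicator A" "\<lambda>a _. 1 - a"] that
    by (auto simp: M_def indicator_def of_bool_def elim!: back_subst[of local_function])
  have empty: "{} \<in> M" by (auto simp: M_def local_function_def intro: exI[of _ "{}"])
  interpret M: algebra UNIV M
    using Un Compl empty by (auto simp: algebra_iff_Un Compl_eq_Diff_UNIV[symmetric])
  have L_nonneg: "0 \<le> L A" if "A \<in> M" for A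
    by (rule tendsto_lowerbound[OF L'[OF that]]) auto
  have L_empty: "L {} = 0" and L_UNIV: "L UNIV = 1"
  proof -
    show "L {} = 0" using tendsto_unique[OF _ L'[OF empty]] by simp
    have "((\<lambda>t. measure (m t) UNIV) \<longlongrightarrow> 1) at_top"
    proof (rule tendsto_eventually)
      show "\<forall>\<^sub>F t in at_top. measure (m t) UNIV = 1"
        using ev by eventually_elim
          (use prob_space.prob_space[OF m(1)] sets_eq_imp_space_eq[OF m(2)] in simp)
    qed
    then show "L UNIV = 1" using tendsto_unique[OF _ L'[OF M.top]] by simp
  qed
  have L_add: "L (A \<union> B) = L A + L B" if "A \<in> M" "B \<in> M" "A \<inter> B = {}" for A B
  proof (rule tendsto_unique[OF _ L'[OF Un[OF that(1,2)]]])
    show "((\<lambda>t. measure (m t) (A \<union> B)) \<longlongrightarrow> L A + L B) at_top"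
    proof (rule Lim_transform_eventually[OF tendsto_add[OF L' L']])
      show "\<forall>\<^sub>F t in at_top. measure (m t) A + measure (m t) B = measure (m t) (A \<union> B)"
        using ev
      proof eventually_elim
        case (elim t)
        interpret prob_space "m t" by (rule m(1)[OF elim])
        show ?case using that M_sets m(2)[OF elim] by (intro finite_measure_Union[symmetric]) auto
      qed
    qed fact+
  qed simp
  have closed: "closed A" if "A \<in> M" for A
  proof -
    have "continuous_on UNIV (indicator A :: _ \<Rightarrow> real)"
      using that by (auto simp: M_def intro: local_function_continuous)
    then have "closed ((indicator A :: _ \<Rightarrow> real) -` {1})" by (simp add: continuous_on_closed_vimage)
    also have "(indicator A :: _ \<Rightarrow> real) -` {1} = A" by (auto simp: indicator_def)
    finally show ?thesis .
  qed
  have "\<exists>\<mu>' :: _ \<Rightarrow> ennreal. (\<forall>A\<in>M. \<mu>' A = ennreal (L A)) \<and> measure_space UNIV (sigma_sets UNIV M) \<mu>'"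
  proof (rule M.caratheodory_empty_continuous)
    show "positive M (\<lambda>A. ennreal (L A))" by (simp add: positive_def L_empty)
    show "additive M (\<lambda>A. ennreal (L A))" by (simp add: additive_def L_add L_nonneg)
    show "(\<lambda>i. ennreal (L (A i))) \<longlonglongrightarrow> 0"
      if A: "range A \<subseteq> M" "decseq A" "(\<Inter>i. A i) = {}" for A :: "nat \<Rightarrow> _"
    proof -
      have "open (- A i)" for i using A(1) closed by (auto simp: open_Compl)
      then obtain I where I: "finite I" "UNIV \<subseteq> (\<Union>i\<in>I. - A i)"
      proof (rule compactE_image[OF compact_configurations])
        show "UNIV \<subseteq> (\<Union>i\<in>UNIV. - A i)" using A(3) by blast
      qed
      have "A n = {}" if "Max (insert 0 I) \<le> n" for n
      proof -
        have "A n \<subseteq> A i" if "i \<in> I" for i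
        proof (rule decseqD[OF A(2)])
          have "i \<le> Max (insert 0 I)" using I(1) that by simp
          then show "i \<le> n" using \<open>Max (insert 0 I) \<le> n\<close> by simp
        qed
        with I(2) show ?thesis by blast
      qed
      then have "\<forall>\<^sub>F n in sequentially. ennreal (L (A n)) = 0"
        unfolding eventually_sequentially by (metis L_empty ennreal_0)
      then show ?thesis by (rule tendsto_eventually)
    qed
  qed simp
  then obtain \<mu>' :: "_ \<Rightarrow> ennreal" where \<mu>': "\<And>A. A \<in> M \<Longrightarrow> \<mu>' A = ennreal (L A)"
    "measure_space UNIV (sigma_sets UNIV M) \<mu>'" by blast
  define \<mu> where "\<mu> = measure_of UNIV M \<mu>'"
  have sets_\<mu>: "sets \<mu> = sets config_space"
  proof -
    have "sets \<mu> = sigma_sets UNIV M" by (simp add: \<mu>_def)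
    also have "\<dots> = sets config_space"
    proof
      show "sigma_sets UNIV M \<subseteq> sets config_space"
        using sets.sigma_sets_subset[of M config_space] M_sets by auto
      have "{\<eta>. \<eta> x \<in> B} \<in> M" for x B
        unfolding M_def local_function_def indicator_def mem_Collect_eq
        by (intro exI[of _ "{x}"]) auto
      moreover have "UNIV \<rightarrow>\<^sub>E space (count_space UNIV) = (UNIV :: ('v \<Rightarrow> bool) set)"
        by (simp add: PiE_UNIV_domain)
      ultimately show "sets config_space \<subseteq> sigma_sets UNIV M"
        unfolding config_space_def sets_PiM_single by (simp only:) (intro sigma_sets_mono', auto)
    qed
    finally show ?thesis .
  qed
  have emeasure_\<mu>: "emeasure \<mu> A = ennreal (L A)" if "A \<in> M" for A
  proof -
    have "emeasure \<mu> A = \<mu>' A"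
    proof (rule emeasure_measure_of[OF \<mu>_def])
      show "positive (sets \<mu>) \<mu>'" "countably_additive (sets \<mu>) \<mu>'"
        using \<mu>'(2) by (simp_all add: \<mu>_def measure_space_def)
      show "A \<in> sets \<mu>" using M_sets[OF that] sets_\<mu> by simp
    qed simp
    then show ?thesis using \<mu>'(1)[OF that] by simp
  qed
  have prob_\<mu>: "prob_space \<mu>"
    by (rule prob_spaceI) (simp add: sets_eq_imp_space_eq[OF sets_\<mu>] emeasure_\<mu>[OF M.top] L_UNIV)
  have loc_conv: "((\<lambda>t. \<integral>\<eta>. f \<eta> \<partial>m t) \<longlongrightarrow> (\<integral>\<eta>. f \<eta> \<partial>\<mu>)) at_top" if f: "local_function f" for f
  proof -
    obtain A where A: "finite A"
      "f = (\<lambda>\<eta>. \<Sum>C\<in>Pow A. f (\<lambda>x. x \<in> C) * (\<Prod>x\<in>A. of_bool (\<eta> x = (x \<in> C)) :: real))"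
      using f by (rule local_functionE)
    define Z where "Z C = {\<eta>. \<forall>x\<in>A. \<eta> x = (x \<in> C)}" for C
    have Z_M: "Z C \<in> M" for C
      unfolding M_def local_function_def indicator_def mem_Collect_eq Z_def
      by (intro exI[of _ A]) (use A(1) in auto)
    have "(\<Prod>x\<in>A. of_bool (\<eta> x = (x \<in> C)) :: real) = indicator (Z C) \<eta>" for C \<eta>
      using A(1) by (auto simp: Z_def indicator_def prod_zero_iff)
    then have f_eq: "f = (\<lambda>\<eta>. \<Sum>C\<in>Pow A. f (\<lambda>x. x \<in> C) * indicator (Z C) \<eta>)"
      using A(2) by simp
    have int: "(\<integral>\<eta>. f \<eta> \<partial>n) = (\<Sum>C\<in>Pow A. f (\<lambda>x. x \<in> C) * measure n (Z C))"
      if n: "prob_space n" "sets n = sets config_space" for n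
    proof -
      interpret prob_space n by fact
      have "Z C \<in> sets n" for C using M_sets[OF Z_M] n(2) by simp
      then show ?thesis
        by (subst f_eq) (simp add: Bochner_Integration.integral_sum sets_eq_imp_space_eq[OF n(2)]
          emeasure_eq_measure)
    qed
    have "L (Z C) = measure \<mu> (Z C)" for C
      using emeasure_\<mu>[OF Z_M] L_nonneg[OF Z_M] by (simp add: measure_def)
    then have "((\<lambda>t. \<Sum>C\<in>Pow A. f (\<lambda>x. x \<in> C) * measure (m t) (Z C)) \<longlongrightarrow>
        (\<Sum>C\<in>Pow A. f (\<lambda>x. x \<in> C) * measure \<mu> (Z C))) at_top"
      using L'[OF Z_M] by (intro tendsto_intros) simp
    moreover have "\<forall>\<^sub>F t in at_top. (\<Sum>C\<in>Pow A. f (\<lambda>x. x \<in> C) * measure (m t) (Z C)) = (\<integral>\<eta>. f \<eta> \<partial>m t)"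
      using ev by eventually_elim (use int m in simp)
    ultimately show ?thesis
      unfolding int[OF prob_\<mu> sets_\<mu>] by (rule Lim_transform_eventually)
  qed
  have "((\<lambda>t. \<integral>\<eta>. f \<eta> \<partial>m t) \<longlongrightarrow> (\<integral>\<eta>. f \<eta> \<partial>\<mu>)) at_top"
    if f: "continuous_on UNIV f" for f :: "('v \<Rightarrow> bool) \<Rightarrow> real"
  proof (rule tendstoI)
    fix e :: real assume e: "0 < e"
    obtain g where g: "local_function g" "\<And>\<eta>. \<bar>f \<eta> - g \<eta>\<bar> \<le> e / 3"
      using continuous_approx_local[OF f, of "e / 3"] e by auto
    note close = integral_uniform_close[OF _ _ f local_function_continuous[OF g(1)] g(2)]
    have "\<forall>\<^sub>F t in at_top. dist (\<integral>\<eta>. g \<eta> \<partial>m t) (\<integral>\<eta>. g \<eta> \<partial>\<mu>) < e / 3"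
      using loc_conv[OF g(1)] e by (auto dest!: tendstoD[of _ _ _ "e / 3"])
    with ev show "\<forall>\<^sub>F t in at_top. dist (\<integral>\<eta>. f \<eta> \<partial>m t) (\<integral>\<eta>. f \<eta> \<partial>\<mu>) < e"
    proof eventually_elim
      case (elim t)
      from elim(2) close[OF m(1)[OF elim(1)] m(2)[OF elim(1)]] close[OF prob_\<mu> sets_\<mu>] show ?case
        unfolding dist_real_def by linarith
    qed
  qed
  with prob_\<mu> sets_\<mu> show ?thesis unfolding weak_limit_def by blast
qed

section \<open>A comparison principle for linear evolution equations\<close>

text \<open>
The hypothesis on \<open>u'\<close> is the form in which positivity of off-diagonal rates enters: if \<open>u \<ge> - c\<close> on
\<open>S\<close> then \<open>u' + R * u \<ge> - R * c\<close>. With the integrating factor \<open>exp (R * t)\<close> this is Gronwall's argument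
by Picard iteration: a lower bound \<open>- D * (R * t) ^ k / fact k\<close> integrates to the same bound with
\<open>Suc k\<close> in place of \<open>k\<close>, and these bounds tend to 0.
\<close>

lemma comparison_principle:
  fixes u u' :: "real \<Rightarrow> 'i \<Rightarrow> real" and R C :: real
  assumes cont: "\<And>i. i \<in> S \<Longrightarrow> continuous_on {0..} (\<lambda>t. u t i)"
    and deriv: "\<And>i t. i \<in> S \<Longrightarrow> 0 < t \<Longrightarrow> ((\<lambda>t. u t i) has_real_derivative u' t i) (at t)"
    and R: "0 \<le> R" and C: "\<And>i t. i \<in> S \<Longrightarrow> 0 \<le> t \<Longrightarrow> - C \<le> u t i" "0 \<le> C"
    and init: "\<And>i. i \<in> S \<Longrightarrow> 0 \<le> u 0 i"
    and step: "\<And>i t c. i \<in> S \<Longrightarrow> 0 < t \<Longrightarrow> 0 \<le> c \<Longrightarrow> (\<And>j. j \<in> S \<Longrightarrow> - c \<le> u t j) \<Longrightarrow>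
      - (R * c) \<le> u' t i + R * u t i"
    and i: "i \<in> S" and t: "0 \<le> t"
  shows "0 \<le> u t i"
proof -
  define T where "T = t"
  define D where "D = C * exp (R * T)"
  have D: "0 \<le> D" using C(2) by (simp add: D_def)
  \<comment> \<open>on \<open>[0, T]\<close> the start \<open>exp (R * s) * u s j \<ge> - D\<close> of the iteration comes from the bound \<open>- C\<close>\<close>
  define b where "b k s = D * ((R * s) ^ k / fact k)" for k and s :: real
  have b_nonneg: "0 \<le> b k s" if "0 \<le> s" for k s
    using that D R by (simp add: b_def)
  have b_deriv: "((\<lambda>s. b (Suc k) s) has_real_derivative R * b k s) (at s)" for k s
  proof -
    have "((\<lambda>s. (R * s) ^ Suc k) has_real_derivative real (Suc k) * (R * (R * s) ^ k)) (at s)"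
      using DERIV_power[OF DERIV_cmult_Id[of R s], of "Suc k"] by simp
    then have "((\<lambda>s. D * ((R * s) ^ Suc k / fact (Suc k))) has_real_derivative
        D * (real (Suc k) * (R * (R * s) ^ k) / fact (Suc k))) (at s)"
      by (intro DERIV_cmult DERIV_cdivide)
    also have "D * (real (Suc k) * (R * (R * s) ^ k) / fact (Suc k)) = R * b k s"
      by (simp add: b_def field_simps del: of_nat_Suc)
    finally show ?thesis unfolding b_def .
  qed
  have bound: "- b k s \<le> exp (R * s) * u s j" if "j \<in> S" "0 \<le> s" "s \<le> T" for k s j
    using that
  proof (induction k arbitrary: s j)
    case 0
    have "C * exp (R * s) \<le> D"
      unfolding D_def using 0 C(2) R by (intro mult_left_mono) (auto intro: mult_left_mono)
    moreover have "exp (R * s) * - C \<le> exp (R * s) * u s j"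
      using C(1)[of j s] 0 by (intro mult_left_mono) auto
    ultimately show ?case by (simp add: b_def algebra_simps)
  next
    case (Suc k)
    let ?\<phi> = "\<lambda>r. exp (R * r) * u r j + b (Suc k) r"
    have "?\<phi> 0 \<le> ?\<phi> s"
    proof (rule DERIV_nonneg_imp_increasing_open[OF Suc.prems(2)])
      fix r assume r: "0 < r" "r < s"
      let ?c = "exp (- (R * r)) * b k r"
      have "- ?c \<le> u r i" if "i \<in> S" for i
      proof -
        have "exp (- (R * r)) * - b k r \<le> exp (- (R * r)) * (exp (R * r) * u r i)"
          using Suc.IH[OF that, of r] r Suc.prems by (intro mult_left_mono) auto
        then show ?thesis by (simp add: mult.assoc[symmetric] flip: exp_add)
      qed
      from step[OF Suc.prems(1) r(1) _ this] have "- (R * ?c) \<le> u' r j + R * u r j"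
        using b_nonneg r by simp
      then have "exp (R * r) * - (R * ?c) \<le> exp (R * r) * (u' r j + R * u r j)"
        by (intro mult_left_mono) auto
      moreover have "exp (R * r) * - (R * ?c) = - (R * b k r)"
        by (simp add: exp_minus)
      ultimately have "0 \<le> exp (R * r) * (u' r j + R * u r j) + R * b k r"
        by linarith
      moreover have "(?\<phi> has_real_derivative exp (R * r) * (u' r j + R * u r j) + R * b k r) (at r)"
        using deriv[OF Suc.prems(1) r(1)] b_deriv[of k r]
        by (auto intro!: derivative_eq_intros simp: algebra_simps)
      ultimately show "\<exists>y. (?\<phi> has_real_derivative y) (at r) \<and> 0 \<le> y" by blast
    next
      have "continuous_on {0..s} (\<lambda>r. u r j)"
        using cont[OF Suc.prems(1)] by (rule continuous_on_subset) auto
      then show "continuous_on {0..s} ?\<phi>"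
        unfolding b_def by (intro continuous_intros) auto
    qed
    moreover have "?\<phi> 0 \<ge> 0" using init[OF Suc.prems(1)] by (simp add: b_def)
    ultimately show ?case by linarith
  qed
  have "(\<lambda>k. - b k t) \<longlonglongrightarrow> - (D * 0)"
  proof -
    have "(\<lambda>k. inverse (fact k) * (R * t) ^ k) \<longlonglongrightarrow> 0"
      by (rule summable_LIMSEQ_zero[OF summable_exp])
    then show ?thesis
      unfolding b_def by (intro tendsto_intros) (simp add: field_simps)
  qed
  then have "- (D * 0) \<le> exp (R * t) * u t i"
    by (rule LIMSEQ_le_const2) (use bound[OF i t] in \<open>auto simp: T_def\<close>)
  then show ?thesis by (simp add: zero_le_mult_iff)
qed

text \<open>
A semigroup provides right difference quotients, uniformly in time. A left difference quotient at \<open>t\<close>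
is a right one at \<open>t - h\<close>, and the uniform continuity of \<open>G\<close> moves the limit from \<open>t - h\<close> to \<open>t\<close>.
\<close>

lemma uniform_right_derivative:
  fixes F G :: "real \<Rightarrow> real"
  assumes F: "\<And>e. 0 < e \<Longrightarrow> \<exists>d>0. \<forall>t\<ge>0. \<forall>h. 0 < h \<and> h < d \<longrightarrow> \<bar>(F (t + h) - F t) / h - G t\<bar> \<le> e"
    and G: "\<And>e. 0 < e \<Longrightarrow> \<exists>d>0. \<forall>t\<ge>0. \<forall>h. 0 < h \<and> h < d \<longrightarrow> \<bar>G (t + h) - G t\<bar> \<le> e"
    and t: "0 \<le> t"
  shows "(F has_real_derivative G t) (at t within {0..})"
  unfolding has_field_derivative_iff Lim_within
proof safe
  fix e :: real assume "0 < e"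
  then obtain d d' where d: "0 < d" "0 < d'"
      "\<And>t h. 0 \<le> t \<Longrightarrow> 0 < h \<Longrightarrow> h < d \<Longrightarrow> \<bar>(F (t + h) - F t) / h - G t\<bar> \<le> e / 3"
      "\<And>t h. 0 \<le> t \<Longrightarrow> 0 < h \<Longrightarrow> h < d' \<Longrightarrow> \<bar>G (t + h) - G t\<bar> \<le> e / 3"
    using F[of "e / 3"] G[of "e / 3"] by auto
  have "dist ((F y - F t) / (y - t)) (G t) < e" if y: "0 \<le> y" "0 < dist y t" "dist y t < min d d'" for y
  proof (cases "t < y")
    case True
    then show ?thesis
      using d(3)[OF t, of "y - t"] y \<open>0 < e\<close> by (auto simp: dist_real_def)
  next
    case False
    then have "y < t" using y by auto
    have "\<bar>(F t - F y) / (t - y) - G y\<bar> \<le> e / 3" "\<bar>G t - G y\<bar> \<le> e / 3"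
      using d(3)[OF y(1), of "t - y"] d(4)[OF y(1), of "t - y"] y \<open>y < t\<close> by (auto simp: dist_real_def)
    moreover have "(F t - F y) / (t - y) = (F y - F t) / (y - t)"
      by (metis minus_diff_eq minus_divide_divide)
    ultimately show ?thesis using \<open>0 < e\<close> unfolding dist_real_def by linarith
  qed
  then show "\<exists>d>0. \<forall>y\<in>{0..}. 0 < dist y t \<and> dist y t < d \<longrightarrow> dist ((F y - F t) / (y - t)) (G t) < e"
    using d(1,2) by (intro exI[of _ "min d d'"]) auto
qed

section \<open>Evolution of laws under a Feller semigroup\<close>

locale feller =
  fixes K :: "real \<Rightarrow> ('v \<Rightarrow> bool) \<Rightarrow> ('v \<Rightarrow> bool) measure"
  assumes feller: "feller_semigroup K"
begin

abbreviation S :: "real \<Rightarrow> (('v \<Rightarrow> bool) \<Rightarrow> real) \<Rightarrow> ('v \<Rightarrow> bool) \<Rightarrow> real" where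
  "S t f \<eta> \<equiv> \<integral>\<zeta>. f \<zeta> \<partial>K t \<eta>"

abbreviation evolve :: "('v \<Rightarrow> bool) measure \<Rightarrow> real \<Rightarrow> ('v \<Rightarrow> bool) measure" where
  "evolve \<nu> t \<equiv> Giry_Monad.bind \<nu> (K t)"

lemma kernel: "0 \<le> t \<Longrightarrow> K t \<in> config_space \<rightarrow>\<^sub>M prob_algebra config_space"
  using feller unfolding feller_semigroup_def by blast

lemma kernel_law:
  assumes "0 \<le> t"
  shows "prob_space (K t \<eta>)" "sets (K t \<eta>) = sets config_space"
  using measurable_space[OF kernel[OF assms], of \<eta>] by (simp_all add: space_prob_algebra)

lemma kernel_0: "K 0 \<eta> = return config_space \<eta>"
  using feller unfolding feller_semigroup_def by blast

lemma kernel_add: "0 \<le> s \<Longrightarrow> 0 \<le> t \<Longrightarrow> K (s + t) \<eta> = evolve (K s \<eta>) t"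
  using feller unfolding feller_semigroup_def by blast

lemma S_continuous: "continuous_on UNIV f \<Longrightarrow> 0 \<le> t \<Longrightarrow> continuous_on UNIV (S t f)"
  using feller unfolding feller_semigroup_def by blast

lemma S_strongly_continuous:
  assumes f: "continuous_on UNIV f" and e: "0 < e"
  obtains d where "0 < d" "\<And>t \<eta>. 0 < t \<Longrightarrow> t < d \<Longrightarrow> \<bar>S t f \<eta> - f \<eta>\<bar> \<le> e"
proof -
  have "uniform_limit UNIV (\<lambda>t \<eta>. S t f \<eta>) f (at_right 0)"
    using feller f unfolding feller_semigroup_def by blast
  from uniform_limitD[OF this e] obtain d where
    "0 < d" "\<And>t \<eta>. 0 < t \<Longrightarrow> t < d \<Longrightarrow> dist (S t f \<eta>) (f \<eta>) < e"
    unfolding eventually_at_right_field by auto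
  then show thesis by (intro that[of d]) (auto simp: dist_real_def less_imp_le)
qed

lemma evolve_law:
  assumes "prob_space \<nu>" "sets \<nu> = sets config_space" "0 \<le> t"
  shows "prob_space (evolve \<nu> t)" "sets (evolve \<nu> t) = sets config_space"
proof -
  have "\<nu> \<in> space (prob_algebra config_space)" using assms by (simp add: space_prob_algebra)
  then show "prob_space (evolve \<nu> t)" "sets (evolve \<nu> t) = sets config_space"
    using kernel[OF assms(3)] by (rule prob_space_bind', rule sets_bind')
qed

lemma evolve_integral:
  assumes \<nu>: "prob_space \<nu>" "sets \<nu> = sets config_space" and t: "0 \<le> t" and f: "continuous_on UNIV f"
  shows "(\<integral>\<eta>. f \<eta> \<partial>evolve \<nu> t) = (\<integral>\<eta>. S t f \<eta> \<partial>\<nu>)"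
proof -
  interpret prob_space \<nu> by fact
  obtain B where B: "\<And>\<eta>. \<bar>f \<eta>\<bar> \<le> B" using f by (rule continuous_config_bounded) blast
  show ?thesis
  proof (rule integral_bind[where B = B and B' = 1])
    show "f \<in> borel_measurable config_space" by (rule continuous_config_measurable[OF f])
    show "K t \<in> \<nu> \<rightarrow>\<^sub>M subprob_algebra config_space"
      using measurable_prob_algebraD[OF kernel[OF t]] measurable_cong_sets[OF \<nu>(2) refl] by blast
    show "AE \<eta> in \<nu>. emeasure (K t \<eta>) (space (K t \<eta>)) \<le> ennreal 1"
      using prob_space.emeasure_space_1[OF kernel_law(1)[OF t]] by simp
  qed (use B finite_measure_axioms in auto)
qed

lemma evolve_0:
  fixes f :: "('v \<Rightarrow> bool) \<Rightarrow> real"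
  assumes \<nu>: "prob_space \<nu>" "sets \<nu> = sets config_space" and f: "continuous_on UNIV f"
  shows "(\<integral>\<eta>. f \<eta> \<partial>evolve \<nu> 0) = (\<integral>\<eta>. f \<eta> \<partial>\<nu>)"
  using continuous_config_measurable[OF f]
  by (simp add: evolve_integral[OF \<nu> order_refl f] kernel_0 integral_return)

lemma evolve_add:
  assumes \<nu>: "prob_space \<nu>" "sets \<nu> = sets config_space" and t: "0 \<le> t" "0 \<le> s"
    and f: "continuous_on UNIV f"
  shows "(\<integral>\<eta>. f \<eta> \<partial>evolve \<nu> (t + s)) = (\<integral>\<eta>. S s f \<eta> \<partial>evolve \<nu> t)"
proof -
  have "(\<integral>\<eta>. f \<eta> \<partial>evolve \<nu> (t + s)) = (\<integral>\<eta>. S (t + s) f \<eta> \<partial>\<nu>)"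
    using t by (intro evolve_integral \<nu> f) simp
  also have "S (t + s) f = S t (S s f)"
    using evolve_integral[OF kernel_law[OF t(1)] t(2) f] by (simp add: kernel_add[OF t])
  also have "(\<integral>\<eta>. S t (S s f) \<eta> \<partial>\<nu>) = (\<integral>\<eta>. S s f \<eta> \<partial>evolve \<nu> t)"
    by (rule evolve_integral[OF \<nu> t(1) S_continuous[OF f t(2)], symmetric])
  finally show ?thesis .
qed

text \<open>
The pair \<open>(f, g)\<close> belongs to the graph of the generator of the semigroup in the supremum norm.
\<close>

definition generates :: "(('v \<Rightarrow> bool) \<Rightarrow> real) \<Rightarrow> (('v \<Rightarrow> bool) \<Rightarrow> real) \<Rightarrow> bool" where
  "generates f g \<longleftrightarrow> continuous_on UNIV f \<and>
     uniform_limit UNIV (\<lambda>t \<eta>. (S t f \<eta> - f \<eta>) / t) g (at_right 0)"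

lemma generates_continuous:
  assumes "generates f g"
  shows "continuous_on UNIV g"
proof (rule uniform_limit_theorem)
  show "uniform_limit UNIV (\<lambda>t \<eta>. (S t f \<eta> - f \<eta>) / t) g (at_right 0)"
    using assms by (simp add: generates_def)
  have "continuous_on UNIV (\<lambda>\<eta>. (S t f \<eta> - f \<eta>) / t)" if "0 < t" for t
    using assms S_continuous[of f t] that
    by (intro continuous_on_divide continuous_on_diff continuous_on_const) (auto simp: generates_def)
  then show "\<forall>\<^sub>F t in at_right 0. continuous_on UNIV (\<lambda>\<eta>. (S t f \<eta> - f \<eta>) / t)"
    using eventually_at_right_less[of "0::real"] by (auto elim!: eventually_mono)
qed simp

lemma generates_uniform:
  assumes fg: "generates f g" and e: "0 < e"
  obtains d where "0 < d" "\<And>\<nu> t. prob_space \<nu> \<Longrightarrow> sets \<nu> = sets config_space \<Longrightarrow> 0 < t \<Longrightarrow> t < d \<Longrightarrow>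
    \<bar>((\<integral>\<eta>. S t f \<eta> \<partial>\<nu>) - (\<integral>\<eta>. f \<eta> \<partial>\<nu>)) / t - (\<integral>\<eta>. g \<eta> \<partial>\<nu>)\<bar> \<le> e"
proof -
  have f: "continuous_on UNIV f" and lim: "uniform_limit UNIV (\<lambda>t \<eta>. (S t f \<eta> - f \<eta>) / t) g (at_right 0)"
    using fg by (auto simp: generates_def)
  obtain d where d: "0 < d" "\<And>t \<eta>. 0 < t \<Longrightarrow> t < d \<Longrightarrow> dist ((S t f \<eta> - f \<eta>) / t) (g \<eta>) < e"
    using uniform_limitD[OF lim e] unfolding eventually_at_right_field by auto
  show thesis
  proof (rule that[OF d(1)])
    fix \<nu> :: "('v \<Rightarrow> bool) measure" and t :: real
    assume \<nu>: "prob_space \<nu>" "sets \<nu> = sets config_space" and t: "0 < t" "t < d"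
    have Sf: "continuous_on UNIV (S t f)" using S_continuous[OF f] t by simp
    have "((\<integral>\<eta>. S t f \<eta> \<partial>\<nu>) - (\<integral>\<eta>. f \<eta> \<partial>\<nu>)) / t = (\<integral>\<eta>. (S t f \<eta> - f \<eta>) / t \<partial>\<nu>)"
      using integrable_continuous_config[OF \<nu> Sf] integrable_continuous_config[OF \<nu> f] by simp
    also have "\<bar>\<dots> - (\<integral>\<eta>. g \<eta> \<partial>\<nu>)\<bar> \<le> e"
      using d(2)[OF t] Sf f t
      by (intro integral_uniform_close[OF \<nu> _ generates_continuous[OF fg]] continuous_intros)
        (auto simp: dist_real_def less_imp_le)
    finally show "\<bar>((\<integral>\<eta>. S t f \<eta> \<partial>\<nu>) - (\<integral>\<eta>. f \<eta> \<partial>\<nu>)) / t - (\<integral>\<eta>. g \<eta> \<partial>\<nu>)\<bar> \<le> e" .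
  qed
qed

text \<open>
Kolmogorov's forward equation. By the Markov property the increment over \<open>[t, t + h]\<close> is an integral
of \<open>S h f - f\<close> against the law at time \<open>t\<close>, so the bounds do not depend on \<open>t\<close>.
\<close>

lemma evolve_has_derivative:
  assumes \<nu>: "prob_space \<nu>" "sets \<nu> = sets config_space" and fg: "generates f g" and t: "0 \<le> t"
  shows "((\<lambda>t. \<integral>\<eta>. f \<eta> \<partial>evolve \<nu> t) has_real_derivative (\<integral>\<eta>. g \<eta> \<partial>evolve \<nu> t)) (at t within {0..})"
proof (rule uniform_right_derivative[OF _ _ t])
  have f: "continuous_on UNIV f" using fg by (simp add: generates_def)
  note g = generates_continuous[OF fg]
  fix e :: real assume e: "0 < e"
  obtain d where d: "0 < d" "\<And>\<nu> t. prob_space \<nu> \<Longrightarrow> sets \<nu> = sets config_space \<Longrightarrow> 0 < t \<Longrightarrow> t < d \<Longrightarrow>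
    \<bar>((\<integral>\<eta>. S t f \<eta> \<partial>\<nu>) - (\<integral>\<eta>. f \<eta> \<partial>\<nu>)) / t - (\<integral>\<eta>. g \<eta> \<partial>\<nu>)\<bar> \<le> e"
    using generates_uniform[OF fg e] by blast
  show "\<exists>d>0. \<forall>t\<ge>0. \<forall>h. 0 < h \<and> h < d \<longrightarrow>
      \<bar>((\<integral>\<eta>. f \<eta> \<partial>evolve \<nu> (t + h)) - (\<integral>\<eta>. f \<eta> \<partial>evolve \<nu> t)) / h - (\<integral>\<eta>. g \<eta> \<partial>evolve \<nu> t)\<bar> \<le> e"
    using d(1) d(2)[OF evolve_law[OF \<nu>]] by (auto simp: evolve_add[OF \<nu> _ _ f] intro!: exI[of _ d])
  obtain d' where d': "0 < d'" "\<And>t \<eta>. 0 < t \<Longrightarrow> t < d' \<Longrightarrow> \<bar>S t g \<eta> - g \<eta>\<bar> \<le> e"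
    using S_strongly_continuous[OF g e] by blast
  show "\<exists>d>0. \<forall>t\<ge>0. \<forall>h. 0 < h \<and> h < d \<longrightarrow>
      \<bar>(\<integral>\<eta>. g \<eta> \<partial>evolve \<nu> (t + h)) - (\<integral>\<eta>. g \<eta> \<partial>evolve \<nu> t)\<bar> \<le> e"
  proof (intro exI[of _ d'] conjI allI impI)
    fix t h :: real assume t: "0 \<le> t" and h: "0 < h \<and> h < d'"
    then show "\<bar>(\<integral>\<eta>. g \<eta> \<partial>evolve \<nu> (t + h)) - (\<integral>\<eta>. g \<eta> \<partial>evolve \<nu> t)\<bar> \<le> e"
      using evolve_add[OF \<nu> t _ g, of h] S_continuous[OF g, of h] d'(2)[of h]
      by (auto intro!: integral_uniform_close[OF evolve_law[OF \<nu> t] _ g])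
  qed (rule d'(1))
qed

text \<open>
By the Feller property the limit is invariant: replacing \<open>f\<close> by \<open>S h f\<close> only shifts time by \<open>h\<close>.
Hence the difference quotients of \<open>f\<close> integrate to 0, and so does their uniform limit \<open>g\<close>.
\<close>

lemma weak_limit_stationary:
  assumes \<nu>: "prob_space \<nu>" "sets \<nu> = sets config_space" and fg: "generates f g"
    and lim: "weak_limit (evolve \<nu>) \<mu>"
  shows "(\<integral>\<eta>. g \<eta> \<partial>\<mu>) = 0"
proof -
  have f: "continuous_on UNIV f" using fg by (simp add: generates_def)
  have \<mu>: "prob_space \<mu>" "sets \<mu> = sets config_space"
    and conv: "\<And>f :: ('v \<Rightarrow> bool) \<Rightarrow> real. continuous_on UNIV f \<Longrightarrow>
      ((\<lambda>t. \<integral>\<eta>. f \<eta> \<partial>evolve \<nu> t) \<longlongrightarrow> (\<integral>\<eta>. f \<eta> \<partial>\<mu>)) at_top"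
    using lim unfolding weak_limit_def by blast+
  have inv: "(\<integral>\<eta>. S h f \<eta> \<partial>\<mu>) = (\<integral>\<eta>. f \<eta> \<partial>\<mu>)" if h: "0 < h" for h
  proof (rule tendsto_unique[OF _ _ conv[OF f]])
    have "((\<lambda>t. \<integral>\<eta>. f \<eta> \<partial>evolve \<nu> (t + h)) \<longlongrightarrow> (\<integral>\<eta>. S h f \<eta> \<partial>\<mu>)) at_top"
    proof (rule Lim_transform_eventually[OF conv])
      show "continuous_on UNIV (S h f)" using S_continuous[OF f] h by simp
      show "\<forall>\<^sub>F t in at_top. (\<integral>\<eta>. S h f \<eta> \<partial>evolve \<nu> t) = (\<integral>\<eta>. f \<eta> \<partial>evolve \<nu> (t + h))"
        using eventually_ge_at_top[of 0] by eventually_elim (use evolve_add[OF \<nu> _ _ f] h in simp)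
    qed
    moreover have "filterlim (\<lambda>t. t - h) at_top at_top" by real_asymp
    ultimately have "((\<lambda>t. \<integral>\<eta>. f \<eta> \<partial>evolve \<nu> (t - h + h)) \<longlongrightarrow> (\<integral>\<eta>. S h f \<eta> \<partial>\<mu>)) at_top"
      by (rule filterlim_compose)
    then show "((\<lambda>t. \<integral>\<eta>. f \<eta> \<partial>evolve \<nu> t) \<longlongrightarrow> (\<integral>\<eta>. S h f \<eta> \<partial>\<mu>)) at_top" by simp
  qed simp
  have "\<bar>\<integral>\<eta>. g \<eta> \<partial>\<mu>\<bar> \<le> e" if e: "0 < e" for e
  proof -
    obtain d where d: "0 < d" "\<And>\<nu> t. prob_space \<nu> \<Longrightarrow> sets \<nu> = sets config_space \<Longrightarrow> 0 < t \<Longrightarrow> t < d \<Longrightarrow>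
      \<bar>((\<integral>\<eta>. S t f \<eta> \<partial>\<nu>) - (\<integral>\<eta>. f \<eta> \<partial>\<nu>)) / t - (\<integral>\<eta>. g \<eta> \<partial>\<nu>)\<bar> \<le> e"
      using generates_uniform[OF fg e] by blast
    show ?thesis using d(2)[OF \<mu>, of "d / 2"] d(1) inv[of "d / 2"] by simp
  qed
  then have "\<bar>\<integral>\<eta>. g \<eta> \<partial>\<mu>\<bar> \<le> 0" by (rule field_le_epsilon[of _ 0, simplified])
  then show ?thesis by simp
qed

end

section \<open>Duality: the evolution of the hole probabilities\<close>

lemma
  assumes "irreducible_symmetric_rates p"
  shows rates_nonneg: "0 \<le> p x y"
    and rates_sym: "p x y = p y x"
    and rates_irreducible: "\<exists>n\<ge>1. 0 < n_step p n x y"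
    and rates_summable: "p x summable_on UNIV"
  using assms unfolding irreducible_symmetric_rates_def by blast+

lemma rates_bounded:
  assumes "irreducible_symmetric_rates p"
  obtains R where "0 \<le> R" "\<And>x. (\<Sum>\<^sub>\<infinity>y. p x y) \<le> R"
proof -
  obtain R where "\<And>x. (\<Sum>\<^sub>\<infinity>y. p x y) \<le> R"
    using assms unfolding irreducible_symmetric_rates_def bdd_above_def by auto
  then show thesis by (intro that[of "max 0 R"]) (auto simp: le_max_iff_disj)
qed

lemma rates_summable_bounded:
  fixes c :: "'v \<Rightarrow> real"
  assumes p: "irreducible_symmetric_rates p" and c: "\<And>y. \<bar>c y\<bar> \<le> C"
  shows "(\<lambda>y. p x y * c y) summable_on UNIV"
proof -
  have "(\<lambda>y. norm (p x y * c y)) summable_on UNIV"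
  proof (rule Infinite_Sum.abs_summable_on_comparison_test')
    show "(\<lambda>y. p x y * C) summable_on UNIV"
      by (rule summable_on_cmult_left[OF rates_summable[OF p]])
    show "norm (p x y * c y) \<le> p x y * C" for y
      using c[of y] rates_nonneg[OF p, of x y] by (simp add: abs_mult mult_left_mono)
  qed
  then show ?thesis by (rule abs_summable_summable)
qed

lemma has_sum_minus:
  fixes f g :: "'a \<Rightarrow> real"
  assumes "(f has_sum s) X" "(g has_sum t) X"
  shows "((\<lambda>x. f x - g x) has_sum (s - t)) X"
  using has_sum_add[OF assms(1), of "\<lambda>x. - g x" "- t"] assms(2) by (simp add: has_sum_uminus)

lemma has_sum_finite_sum:
  fixes f :: "'i \<Rightarrow> 'a \<Rightarrow> real"
  assumes "finite A" "\<And>a. a \<in> A \<Longrightarrow> (f a has_sum s a) X"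
  shows "((\<lambda>x. \<Sum>a\<in>A. f a x) has_sum (\<Sum>a\<in>A. s a)) X"
  using assms by (induction A rule: finite_induct) (auto intro: has_sum_add)

lemma has_sum_row:
  fixes g :: "'b \<Rightarrow> real"
  assumes "(g has_sum s) UNIV"
  shows "((\<lambda>(x, y). of_bool (x = a) * g y) has_sum s) UNIV"
    and "((\<lambda>(y, x). of_bool (x = a) * g y) has_sum s) UNIV"
proof -
  have "((\<lambda>(x, y). of_bool (x = a) * g y) has_sum s) (range (Pair a))"
    by (subst has_sum_reindex) (use assms in \<open>auto simp: o_def inj_on_def\<close>)
  then show "((\<lambda>(x, y). of_bool (x = a) * g y) has_sum s) UNIV"
    by (subst has_sum_cong_neutral[where S = UNIV and T = "range (Pair a)"]) auto
  have "((\<lambda>(y, x). of_bool (x = a) * g y) has_sum s) (range (\<lambda>y. (y, a)))"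
    by (subst has_sum_reindex) (use assms in \<open>auto simp: o_def inj_on_def\<close>)
  then show "((\<lambda>(y, x). of_bool (x = a) * g y) has_sum s) UNIV"
    by (subst has_sum_cong_neutral[where S = UNIV and T = "range (\<lambda>y. (y, a))"]) auto
qed

text \<open>
The generator of the dual process: the points of \<open>A\<close> jump independently of each other at rates \<open>p\<close>,
jumps onto occupied sites being suppressed, and \<open>A\<close> is killed at rate \<open>lam\<close> while it contains \<open>v0\<close>.
\<close>

definition hole_generator ::
  "('v \<Rightarrow> 'v \<Rightarrow> real) \<Rightarrow> real \<Rightarrow> 'v \<Rightarrow> ('v set \<Rightarrow> real) \<Rightarrow> 'v set \<Rightarrow> real" where
  "hole_generator p lam v0 u A =
     (\<Sum>x\<in>A. \<Sum>\<^sub>\<infinity>y. p x y * (of_bool (y \<notin> A) * (u (insert y (A - {x})) - u A)))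
     - lam * of_bool (v0 \<in> A) * u A"

text \<open>
A jump from \<open>x\<close> to \<open>y\<close> creates the event that \<open>A\<close> is vacant if \<open>x\<close> held the only particle in \<open>A\<close> and
\<open>y\<close> lies outside, and destroys it if \<open>x\<close> lies outside and \<open>y\<close> inside. Written as finite sums over \<open>A\<close>, the
contributions become series in the other variable alone.
\<close>

lemma exchange_term:
  assumes "finite A"
  shows "p x y * of_bool (\<eta> x) * (1 - of_bool (\<eta> y)) * (vacant A (move_particle x y \<eta>) - vacant A \<eta>) =
    (\<Sum>a\<in>A. of_bool (x = a) * (p a y * (of_bool (y \<notin> A) * of_bool (\<eta> a) * (1 - of_bool (\<eta> y)) * vacant (A - {a}) \<eta>)))
    - (\<Sum>a\<in>A. of_bool (y = a) * (p x a * (of_bool (x \<notin> A) * of_bool (\<eta> x) * vacant A \<eta>)))"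
proof -
  have "(\<Sum>a\<in>A. of_bool (x = a) * (p a y * (of_bool (y \<notin> A) * of_bool (\<eta> a) * (1 - of_bool (\<eta> y)) * vacant (A - {a}) \<eta>)))
    = of_bool (x \<in> A) * (p x y * (of_bool (y \<notin> A) * of_bool (\<eta> x) * (1 - of_bool (\<eta> y)) * vacant (A - {x}) \<eta>))"
    using assms by (simp add: of_bool_def if_distrib[of "\<lambda>c. c * _"] cong: if_cong)
  moreover have "(\<Sum>a\<in>A. of_bool (y = a) * (p x a * (of_bool (x \<notin> A) * of_bool (\<eta> x) * vacant A \<eta>)))
    = of_bool (y \<in> A) * (p x y * (of_bool (x \<notin> A) * of_bool (\<eta> x) * vacant A \<eta>))"
    using assms by (simp add: of_bool_def if_distrib[of "\<lambda>c. c * _"] cong: if_cong)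
  moreover have "vacant A (move_particle x y \<eta>) - vacant A \<eta> =
      of_bool (x \<in> A) * (of_bool (y \<notin> A) * vacant (A - {x}) \<eta>) - of_bool (y \<in> A) * (of_bool (x \<notin> A) * vacant A \<eta>)"
    if "\<eta> x" "\<not> \<eta> y"
    using that unfolding vacant_def move_particle_def by (cases "x = y") auto
  ultimately show ?thesis by (cases "\<eta> x \<and> \<not> \<eta> y") (auto simp: vacant_def)
qed

text \<open>
Self-duality of symmetric exclusion: by the symmetry of \<open>p\<close> the rate of losing the vacancy of \<open>A\<close>
through a jump from \<open>y\<close> to \<open>a\<close> can be combined with that of gaining it through a jump from \<open>a\<close> to \<open>y\<close>,
and the quadratic terms in the occupation of \<open>a\<close> and \<open>y\<close> cancel.
\<close>

lemma generator_vacant: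
  assumes p: "irreducible_symmetric_rates p" and A: "finite A"
  shows "sep_source_generator p lam v0 (vacant A) \<eta> = hole_generator p lam v0 (\<lambda>B. vacant B \<eta>) A"
proof -
  let ?g1 = "\<lambda>a y. p a y * (of_bool (y \<notin> A) * of_bool (\<eta> a) * (1 - of_bool (\<eta> y)) * vacant (A - {a}) \<eta>)"
  let ?g2 = "\<lambda>a y. p y a * (of_bool (y \<notin> A) * of_bool (\<eta> y) * vacant A \<eta>)"
  have s1: "?g1 a summable_on UNIV" for a
    by (rule rates_summable_bounded[OF p, where C = 1]) (auto simp: vacant_def)
  have s2: "?g2 a summable_on UNIV" for a
    unfolding rates_sym[OF p, of _ a]
    by (rule rates_summable_bounded[OF p, where C = 1]) (auto simp: vacant_def)
  have "((\<lambda>(x, y). p x y * of_bool (\<eta> x) * (1 - of_bool (\<eta> y)) *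
        (vacant A (move_particle x y \<eta>) - vacant A \<eta>)) has_sum
      ((\<Sum>a\<in>A. \<Sum>\<^sub>\<infinity>y. ?g1 a y) - (\<Sum>a\<in>A. \<Sum>\<^sub>\<infinity>y. ?g2 a y))) UNIV"
    unfolding exchange_term[OF A] split_def
    by (intro has_sum_minus has_sum_finite_sum A has_sum_row(1)[OF has_sum_infsum[OF s1], unfolded split_def]
      has_sum_row(2)[OF has_sum_infsum[OF s2], unfolded split_def])
  then have "(\<Sum>\<^sub>\<infinity>(x, y). p x y * of_bool (\<eta> x) * (1 - of_bool (\<eta> y)) *
        (vacant A (move_particle x y \<eta>) - vacant A \<eta>)) =
      (\<Sum>a\<in>A. (\<Sum>\<^sub>\<infinity>y. ?g1 a y) - (\<Sum>\<^sub>\<infinity>y. ?g2 a y))"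
    by (simp add: infsumI sum_subtractf)
  also have "\<dots> = (\<Sum>a\<in>A. \<Sum>\<^sub>\<infinity>y. p a y * (of_bool (y \<notin> A) * (vacant (insert y (A - {a})) \<eta> - vacant A \<eta>)))"
  proof (rule sum.cong[OF refl])
    fix a assume a: "a \<in> A"
    have "(\<Sum>\<^sub>\<infinity>y. ?g1 a y) - (\<Sum>\<^sub>\<infinity>y. ?g2 a y) = (\<Sum>\<^sub>\<infinity>y. ?g1 a y - ?g2 a y)"
      by (intro infsumI[symmetric] has_sum_minus has_sum_infsum s1 s2)
    also have "\<dots> = (\<Sum>\<^sub>\<infinity>y. p a y * (of_bool (y \<notin> A) * (vacant (insert y (A - {a})) \<eta> - vacant A \<eta>)))"
      using a by (intro infsum_cong) (auto simp: vacant_def rates_sym[OF p, of _ a])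
    finally show "(\<Sum>\<^sub>\<infinity>y. ?g1 a y) - (\<Sum>\<^sub>\<infinity>y. ?g2 a y) =
      (\<Sum>\<^sub>\<infinity>y. p a y * (of_bool (y \<notin> A) * (vacant (insert y (A - {a})) \<eta> - vacant A \<eta>)))" .
  qed
  moreover have "lam * (1 - of_bool (\<eta> v0)) * (vacant A (flip_at v0 \<eta>) - vacant A \<eta>) =
      - (lam * of_bool (v0 \<in> A) * vacant A \<eta>)"
    by (cases "\<eta> v0"; cases "v0 \<in> A") (auto simp: vacant_def flip_at_def)
  ultimately show ?thesis
    unfolding sep_source_generator_def hole_generator_def by simp
qed

lemma hole_summable:
  assumes p: "irreducible_symmetric_rates p" and u: "\<And>B. \<bar>u B\<bar> \<le> C"
  shows "(\<lambda>y. p x y * (of_bool (y \<notin> A) * (u (insert y (A - {x})) - u A))) summable_on UNIV"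
proof (rule rates_summable_bounded[OF p])
  fix y show "\<bar>of_bool (y \<notin> A) * (u (insert y (A - {x})) - u A)\<bar> \<le> 2 * C"
    using u[of "insert y (A - {x})"] u[of A] by (cases "y \<in> A") auto
qed

lemma hole_generator_diff:
  assumes p: "irreducible_symmetric_rates p" and u: "\<And>B. \<bar>u B\<bar> \<le> C" and v: "\<And>B. \<bar>v B\<bar> \<le> C"
  shows "hole_generator p lam v0 (\<lambda>B. u B - v B) A = hole_generator p lam v0 u A - hole_generator p lam v0 v A"
proof -
  have "(\<Sum>\<^sub>\<infinity>y. p x y * (of_bool (y \<notin> A) * ((u (insert y (A - {x})) - v (insert y (A - {x}))) - (u A - v A)))) =
      (\<Sum>\<^sub>\<infinity>y. p x y * (of_bool (y \<notin> A) * (u (insert y (A - {x})) - u A))) -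
      (\<Sum>\<^sub>\<infinity>y. p x y * (of_bool (y \<notin> A) * (v (insert y (A - {x})) - v A)))" for x
    using has_sum_minus[OF has_sum_infsum[OF hole_summable[of p u C x A, OF p u]]
      has_sum_infsum[OF hole_summable[of p v C x A, OF p v]]]
    by (intro infsumI) (simp add: algebra_simps)
  then show ?thesis
    unfolding hole_generator_def by (simp only: sum_subtractf) (simp add: right_diff_distrib)
qed

text \<open>
Positivity of the jump rates, with the diagonal compensated by the total rate
\<open>card A * R + lam\<close>; jumps preserve the number of points, so only sets of the size of \<open>A\<close> matter.
\<close>

lemma hole_generator_lower_bound:
  fixes R :: real
  assumes p: "irreducible_symmetric_rates p" and lam: "0 \<le> lam"
    and R: "\<And>x. (\<Sum>\<^sub>\<infinity>y. p x y) \<le> R" and u: "\<And>B. \<bar>u B\<bar> \<le> C"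
    and A: "finite A" and c: "0 \<le> c" "\<And>B. finite B \<Longrightarrow> card B = card A \<Longrightarrow> - c \<le> u B"
  shows "- ((real (card A) * R + lam) * c) \<le> hole_generator p lam v0 u A + (real (card A) * R + lam) * u A"
proof -
  have uA: "0 \<le> c + u A" using c(2)[OF A] by simp
  have "- (R * (c + u A)) \<le> (\<Sum>\<^sub>\<infinity>y. p x y * (of_bool (y \<notin> A) * (u (insert y (A - {x})) - u A)))"
    if x: "x \<in> A" for x
  proof -
    have "- (R * (c + u A)) \<le> (\<Sum>\<^sub>\<infinity>y. p x y) * - (c + u A)"
      using mult_right_mono[OF R[of x] uA] by (simp only: mult_minus_right neg_le_iff_le)
    also have "\<dots> = (\<Sum>\<^sub>\<infinity>y. p x y * - (c + u A))"
      by (rule infsum_cmult_left'[symmetric])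
    also have "\<dots> \<le> (\<Sum>\<^sub>\<infinity>y. p x y * (of_bool (y \<notin> A) * (u (insert y (A - {x})) - u A)))"
    proof (rule infsum_mono)
      show "(\<lambda>y. p x y * - (c + u A)) summable_on UNIV"
        by (rule summable_on_cmult_left[OF rates_summable[OF p]])
      show "(\<lambda>y. p x y * (of_bool (y \<notin> A) * (u (insert y (A - {x})) - u A))) summable_on UNIV"
        by (rule hole_summable[OF p u])
      fix y
      have "- (c + u A) \<le> of_bool (y \<notin> A) * (u (insert y (A - {x})) - u A)"
      proof (cases "y \<in> A")
        case False
        then have "card (insert y (A - {x})) = card A"
          using A x by (simp add: card.insert_remove card_Suc_Diff1 del: card_Diff_insert)
        from c(2)[OF _ this] A False show ?thesis by simp
      qed (use uA in simp)
      then show "p x y * - (c + u A) \<le> p x y * (of_bool (y \<notin> A) * (u (insert y (A - {x})) - u A))"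
        by (rule mult_left_mono[OF _ rates_nonneg[OF p]])
    qed
    finally show ?thesis .
  qed
  then have "(\<Sum>x\<in>A. - (R * (c + u A))) \<le>
      (\<Sum>x\<in>A. \<Sum>\<^sub>\<infinity>y. p x y * (of_bool (y \<notin> A) * (u (insert y (A - {x})) - u A)))"
    by (rule sum_mono)
  moreover have "- (lam * (c + u A)) \<le> - (lam * of_bool (v0 \<in> A) * u A)"
    using mult_nonneg_nonneg[OF lam uA] mult_nonneg_nonneg[OF lam c(1)]
    by (cases "v0 \<in> A") (auto simp: distrib_left)
  ultimately show ?thesis
    unfolding hole_generator_def by (simp add: algebra_simps)
qed

lemma hole_comparison:
  fixes u u' :: "real \<Rightarrow> 'v set \<Rightarrow> real"
  assumes p: "irreducible_symmetric_rates p" and lam: "0 \<le> lam" and u: "\<And>t B. 0 \<le> t \<Longrightarrow> \<bar>u t B\<bar> \<le> C"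
    and deriv: "\<And>t B. 0 \<le> t \<Longrightarrow> finite B \<Longrightarrow> card B = n \<Longrightarrow>
      ((\<lambda>t. u t B) has_real_derivative u' t B) (at t within {0..})"
    and super: "\<And>t B. 0 \<le> t \<Longrightarrow> finite B \<Longrightarrow> card B = n \<Longrightarrow> hole_generator p lam v0 (u t) B \<le> u' t B"
    and init: "\<And>B. finite B \<Longrightarrow> card B = n \<Longrightarrow> 0 \<le> u 0 B"
    and A: "finite A" "card A = n" and t: "0 \<le> t"
  shows "0 \<le> u t A"
proof -
  obtain R where R: "0 \<le> R" "\<And>x. (\<Sum>\<^sub>\<infinity>y. p x y) \<le> R" using rates_bounded[OF p] by blast
  show ?thesis
  proof (rule comparison_principle[where S = "{B. finite B \<and> card B = n}" and u = u and u' = u'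
        and i = A and t = t and R = "real n * R + lam" and C = C])
    fix B assume B: "B \<in> {B :: 'v set. finite B \<and> card B = n}"
    show "continuous_on {0..} (\<lambda>t. u t B)"
      using B deriv by (intro DERIV_continuous_on) auto
    show "0 \<le> u 0 B" using B init by simp
    show "- C \<le> u t B" if "0 \<le> t" for t using u[of t B] that by simp
    show "((\<lambda>t. u t B) has_real_derivative u' t B) (at t)" if "0 < t" for t
      using deriv[of t B] B that at_within_interior[of t "{0..}"] by simp
    fix t c :: real
    assume t: "0 < t" and c: "0 \<le> c" "\<And>j. j \<in> {B. finite B \<and> card B = n} \<Longrightarrow> - c \<le> u t j"
    have "- ((real (card B) * R + lam) * c) \<le> hole_generator p lam v0 (u t) B + (real (card B) * R + lam) * u t B"
      using B c t by (intro hole_generator_lower_bound[OF p lam R(2) u]) auto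
    also have "\<dots> \<le> u' t B + (real (card B) * R + lam) * u t B"
      using super[of t B] t B by simp
    finally show "- ((real n * R + lam) * c) \<le> u' t B + (real n * R + lam) * u t B" using B by simp
  next
    show "0 \<le> C" using u[of 0 "{}"] by linarith
  qed (use A t R(1) lam in auto)
qed

lemma integral_rate_sum:
  fixes \<phi> :: "'v \<Rightarrow> ('v \<Rightarrow> bool) \<Rightarrow> real"
  assumes p: "irreducible_symmetric_rates p" and m: "prob_space m" "sets m = sets config_space"
    and \<phi>: "\<And>y. continuous_on UNIV (\<phi> y)" "\<And>y \<eta>. \<bar>\<phi> y \<eta>\<bar> \<le> C"
  shows "continuous_on UNIV (\<lambda>\<eta>. \<Sum>\<^sub>\<infinity>y. p x y * \<phi> y \<eta>)"
    and "(\<integral>\<eta>. (\<Sum>\<^sub>\<infinity>y. p x y * \<phi> y \<eta>) \<partial>m) = (\<Sum>\<^sub>\<infinity>y. p x y * (\<integral>\<eta>. \<phi> y \<eta> \<partial>m))"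
proof -
  have lim: "uniform_limit UNIV (\<lambda>Y \<eta>. \<Sum>y\<in>Y. p x y * \<phi> y \<eta>) (\<lambda>\<eta>. \<Sum>\<^sub>\<infinity>y. p x y * \<phi> y \<eta>)
      (finite_subsets_at_top UNIV)"
  proof (rule Weierstrass_m_test_general)
    show "(\<lambda>y. p x y * C) summable_on UNIV"
      by (rule summable_on_cmult_left[OF rates_summable[OF p]])
    show "norm (p x y * \<phi> y \<eta>) \<le> p x y * C" for y \<eta>
      using \<phi>(2)[of y \<eta>] rates_nonneg[OF p, of x y] by (simp add: abs_mult mult_left_mono)
  qed
  have cont: "continuous_on UNIV (\<lambda>\<eta>. \<Sum>y\<in>Y. p x y * \<phi> y \<eta>)" for Y
    by (intro continuous_on_sum continuous_on_mult continuous_on_const \<phi>)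
  show "continuous_on UNIV (\<lambda>\<eta>. \<Sum>\<^sub>\<infinity>y. p x y * \<phi> y \<eta>)"
    by (rule uniform_limit_theorem[OF always_eventually lim]) (use cont in simp_all)
  have "((\<lambda>Y. \<integral>\<eta>. (\<Sum>y\<in>Y. p x y * \<phi> y \<eta>) \<partial>m) \<longlongrightarrow> (\<integral>\<eta>. (\<Sum>\<^sub>\<infinity>y. p x y * \<phi> y \<eta>) \<partial>m))
      (finite_subsets_at_top UNIV)"
    by (rule uniform_limit_integral[OF m lim cont]) simp
  also have "(\<lambda>Y. \<integral>\<eta>. (\<Sum>y\<in>Y. p x y * \<phi> y \<eta>) \<partial>m) = (\<lambda>Y. \<Sum>y\<in>Y. p x y * (\<integral>\<eta>. \<phi> y \<eta> \<partial>m))"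
    using integrable_continuous_config[OF m \<phi>(1)] by (simp add: Bochner_Integration.integral_sum)
  finally have "((\<lambda>y. p x y * (\<integral>\<eta>. \<phi> y \<eta> \<partial>m)) has_sum (\<integral>\<eta>. (\<Sum>\<^sub>\<infinity>y. p x y * \<phi> y \<eta>) \<partial>m)) UNIV"
    unfolding has_sum_def .
  then show "(\<integral>\<eta>. (\<Sum>\<^sub>\<infinity>y. p x y * \<phi> y \<eta>) \<partial>m) = (\<Sum>\<^sub>\<infinity>y. p x y * (\<integral>\<eta>. \<phi> y \<eta> \<partial>m))"
    by (rule infsumI[symmetric])
qed

lemma integral_hole_generator:
  assumes p: "irreducible_symmetric_rates p" and m: "prob_space m" "sets m = sets config_space"
    and A: "finite A"
  shows "(\<integral>\<eta>. hole_generator p lam v0 (\<lambda>B. vacant B \<eta>) A \<partial>m) =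
    hole_generator p lam v0 (\<lambda>B. \<integral>\<eta>. vacant B \<eta> \<partial>m) A"
proof -
  have V: "continuous_on UNIV (vacant B)" if "finite B" for B
    by (rule local_function_continuous[OF vacant_local[OF that]])
  have iV: "integrable m (vacant B)" if "finite B" for B
    by (rule integrable_continuous_config[OF m V[OF that]])
  let ?\<phi> = "\<lambda>x y \<eta>. of_bool (y \<notin> A) * (vacant (insert y (A - {x})) \<eta> - vacant A \<eta>)"
  have \<phi>: "continuous_on UNIV (?\<phi> x y)" "\<bar>?\<phi> x y \<eta>\<bar> \<le> 1" for x y \<eta>
    using A vacant_bounds[of A \<eta>] vacant_bounds[of "insert y (A - {x})" \<eta>]
    by (auto simp: abs_le_iff intro!: continuous_on_mult continuous_on_diff continuous_on_const V)
  define T where "T x \<eta> = (\<Sum>\<^sub>\<infinity>y. p x y * ?\<phi> x y \<eta>)" for x \<eta>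
  have iT: "integrable m (T x)" for x
    unfolding T_def using integral_rate_sum(1)[OF p m \<phi>] by (rule integrable_continuous_config[OF m])
  have "(\<integral>\<eta>. ?\<phi> x y \<eta> \<partial>m) =
      of_bool (y \<notin> A) * ((\<integral>\<eta>. vacant (insert y (A - {x})) \<eta> \<partial>m) - (\<integral>\<eta>. vacant A \<eta> \<partial>m))" for x y
    using iV A by (subst integral_mult_right_zero, subst Bochner_Integration.integral_diff) auto
  then have T: "(\<integral>\<eta>. T x \<eta> \<partial>m) = (\<Sum>\<^sub>\<infinity>y. p x y *
      (of_bool (y \<notin> A) * ((\<integral>\<eta>. vacant (insert y (A - {x})) \<eta> \<partial>m) - (\<integral>\<eta>. vacant A \<eta> \<partial>m))))" for x
    unfolding T_def integral_rate_sum(2)[OF p m \<phi>] by (simp only:)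
  have "(\<integral>\<eta>. (\<Sum>x\<in>A. T x \<eta>) - lam * of_bool (v0 \<in> A) * vacant A \<eta> \<partial>m) =
      (\<Sum>x\<in>A. \<integral>\<eta>. T x \<eta> \<partial>m) - lam * of_bool (v0 \<in> A) * (\<integral>\<eta>. vacant A \<eta> \<partial>m)"
    using iT iV[OF A] by (simp add: Bochner_Integration.integral_sum)
  then show ?thesis
    unfolding hole_generator_def T by (simp only: T_def)
qed

section \<open>Hitting probabilities of the random walk\<close>

lemma random_walkD:
  assumes "random_walk p P X"
  shows random_walk_prob_space: "prob_space (P x)"
    and random_walk_measurable: "0 \<le> t \<Longrightarrow> X t \<in> P x \<rightarrow>\<^sub>M count_space UNIV"
    and random_walk_right_continuous:
      "\<omega> \<in> space (P x) \<Longrightarrow> 0 \<le> t \<Longrightarrow> \<forall>\<^sub>F s in at_right t. X s \<omega> = X t \<omega>"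
    and random_walk_start: "AE \<omega> in P x. X 0 \<omega> = x"
    and random_walk_fdd: "ts 0 = 0 \<Longrightarrow> ys 0 = x \<Longrightarrow> (\<And>i. i < n \<Longrightarrow> ts i < ts (Suc i)) \<Longrightarrow>
        measure (P x) {\<omega> \<in> space (P x). \<forall>i\<le>n. X (ts i) \<omega> = ys i} =
        (\<Prod>i<n. measure (P (ys i))
                  {\<omega> \<in> space (P (ys i)). X (ts (Suc i) - ts i) \<omega> = ys (Suc i)})"
    and random_walk_generator: "bounded (range f) \<Longrightarrow>
        uniform_limit UNIV (\<lambda>t x. ((\<integral>\<omega>. f (X t \<omega>) \<partial>P x) - f x) / t) (rw_generator p f)
          (at_right 0)"
  using assms unfolding random_walk_def by blast+

lemma map_upt_Suc_eq_iff: "map f [0..<Suc n] = l \<longleftrightarrow> length l = Suc n \<and> (\<forall>i\<le>n. f i = l ! i)"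
  unfolding list_eq_iff_nth_eq less_Suc_eq_le[symmetric] length_map length_upt
  by (auto simp del: upt_Suc)

lemma random_walk_at_measurable:
  assumes rw: "random_walk p P X" and "0 \<le> t"
  shows "{\<omega> \<in> space (P x). X t \<omega> = y} \<in> sets (P x)"
proof -
  have "X t -` {y} \<inter> space (P x) \<in> sets (P x)"
    using random_walk_measurable[OF assms] by (rule measurable_sets) simp
  also have "X t -` {y} \<inter> space (P x) = {\<omega> \<in> space (P x). X t \<omega> = y}" by auto
  finally show ?thesis .
qed

lemma path_measurable:
  fixes P :: "'v::countable \<Rightarrow> 'w measure"
  assumes rw: "random_walk p P X" and ts: "\<And>i. i \<le> n \<Longrightarrow> 0 \<le> ts i"
  shows "(\<lambda>\<omega>. map (\<lambda>i. X (ts i) \<omega>) [0..<Suc n]) \<in> P x \<rightarrow>\<^sub>M count_space UNIV"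
proof -
  have "(\<lambda>\<omega>. map (\<lambda>i. X (ts i) \<omega>) [0..<Suc n]) -` {l} \<inter> space (P x) \<in> sets (P x)" for l :: "'v list"
  proof -
    have "(\<lambda>\<omega>. map (\<lambda>i. X (ts i) \<omega>) [0..<Suc n]) -` {l} \<inter> space (P x) =
      {\<omega> \<in> space (P x). length l = Suc n \<and> (\<forall>i\<in>{..n}. X (ts i) \<omega> = l ! i)}"
      unfolding vimage_def singleton_iff map_upt_Suc_eq_iff by auto
    also have "\<dots> \<in> sets (P x)"
      using random_walk_at_measurable[OF rw ts]
      by (intro sets.sets_Collect sets.sets_Collect_finite_All') auto
    finally show ?thesis .
  qed
  then show ?thesis
    unfolding measurable_count_space_eq_countable[OF countableI_type] by blast
qed

text \<open>
The Markov property at time \<open>t\<close> for a finite path. Both sides are laws on a countable space of lists,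
so it is enough to compare the weights of single paths, where the product formula for the
finite-dimensional distributions splits off the first factor.
\<close>

lemma path_shift_distr:
  fixes P :: "'v::countable \<Rightarrow> 'w measure"
  assumes rw: "random_walk p P X" and ts0: "ts 0 = 0" and ts: "\<And>i. i < n \<Longrightarrow> ts i < ts (Suc i)"
    and t: "0 < t"
  shows "distr (P x) (count_space UNIV) (\<lambda>\<omega>. map (\<lambda>i. X (t + ts i) \<omega>) [0..<Suc n]) =
    Giry_Monad.bind (distr (P x) (count_space UNIV) (X t))
      (\<lambda>y. distr (P y) (count_space UNIV) (\<lambda>\<omega>. map (\<lambda>i. X (ts i) \<omega>) [0..<Suc n]))"
    (is "?L = Giry_Monad.bind ?D ?N")
proof -
  note upt_Suc[simp del]
  interpret P: prob_space "P y" for y by (rule random_walk_prob_space[OF rw])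
  have ts_nn: "0 \<le> ts i" if "i \<le> n" for i
    using that
  proof (induction i)
    case (Suc i) then show ?case using ts[of i] by simp
  qed (simp add: ts0)
  have Xt[measurable]: "X t \<in> P y \<rightarrow>\<^sub>M count_space UNIV" for y
    using random_walk_measurable[OF rw] t by simp
  note pm = path_measurable[OF rw, of n "\<lambda>i. t + ts i"] path_measurable[OF rw, of n ts]
  have pm1[measurable]: "(\<lambda>\<omega>. map (\<lambda>i. X (t + ts i) \<omega>) [0..<Suc n]) \<in> P y \<rightarrow>\<^sub>M count_space UNIV" for y
    using ts_nn t by (intro pm) (simp add: add_nonneg_nonneg)
  have pm2[measurable]: "(\<lambda>\<omega>. map (\<lambda>i. X (ts i) \<omega>) [0..<Suc n]) \<in> P y \<rightarrow>\<^sub>M count_space UNIV" for y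
    using ts_nn by (intro pm)
  have N: "?N \<in> ?D \<rightarrow>\<^sub>M subprob_algebra (count_space UNIV)"
    by (auto simp: space_subprob_algebra intro!: prob_space_imp_subprob_space P.prob_space_distr)
  \<comment> \<open>a path from \<open>y\<close> starts at \<open>y\<close>, so only one \<open>y\<close> contributes to the weight of a given list\<close>
  have N_start: "emeasure (?N y) {l} = 0" if "y \<noteq> hd l" for y and l :: "'v list"
  proof -
    have "AE \<omega> in P y. \<not> map (\<lambda>i. X (ts i) \<omega>) [0..<Suc n] = l"
      using random_walk_start[OF rw, of y]
      by eventually_elim (use that ts0 in \<open>auto simp: upt_conv_Cons\<close>)
    then show ?thesis
      by (subst emeasure_distr) (auto simp: AE_iff_measurable[OF _ refl] vimage_def Int_def conj_commute)
  qed
  have *: "emeasure ?L {l} = emeasure (?N (hd l)) {l} * emeasure ?D {hd l}" for l :: "'v list"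
  proof (cases "length l = Suc n")
    case False
    then have "(\<lambda>\<omega>. map (\<lambda>i. X (s i) \<omega>) [0..<Suc n]) -` {l} = {}" for s
      by (auto)
    then show ?thesis
      by (subst (1 2) emeasure_distr) (auto)
  next
    case True
    then have hd: "hd l = l ! 0" by (cases l) auto
    have pre: "(\<lambda>\<omega>. map (\<lambda>i. X (s i) \<omega>) [0..<Suc n]) -` {l} \<inter> space (P y) =
        {\<omega> \<in> space (P y). \<forall>i\<le>n. X (s i) \<omega> = l ! i}" for s y
      using True unfolding vimage_def singleton_iff map_upt_Suc_eq_iff by auto
    have m1: "{\<omega> \<in> space (P x). \<forall>i\<le>n. X (t + ts i) \<omega> = l ! i} \<in> sets (P x)"
      unfolding pre[symmetric] by (rule measurable_sets[OF pm1]) simp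
    \<comment> \<open>prepend the starting time 0 and the starting point to reach the form of the product formula\<close>
    let ?ts = "case_nat 0 (\<lambda>i. t + ts i)" and ?ys = "case_nat x (\<lambda>i. l ! i)"
    have "{\<omega> \<in> space (P x). X 0 \<omega> = x} \<in> sets (P x)"
      by (rule random_walk_at_measurable[OF rw order_refl])
    moreover have split: "{\<omega> \<in> space (P x). \<forall>i\<le>Suc n. X (?ts i) \<omega> = ?ys i} =
      {\<omega> \<in> space (P x). X 0 \<omega> = x} \<inter> {\<omega> \<in> space (P x). \<forall>i\<le>n. X (t + ts i) \<omega> = l ! i}"
      unfolding less_Suc_eq_le[symmetric] All_less_Suc2 by auto
    ultimately have "measure (P x) {\<omega> \<in> space (P x). \<forall>i\<le>n. X (t + ts i) \<omega> = l ! i} =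
        measure (P x) {\<omega> \<in> space (P x). \<forall>i\<le>Suc n. X (?ts i) \<omega> = ?ys i}"
      unfolding split
    proof (intro measure_eq_AE m1 sets.Int)
      show "AE \<omega> in P x. (\<omega> \<in> {\<omega> \<in> space (P x). \<forall>i\<le>n. X (t + ts i) \<omega> = l ! i}) =
          (\<omega> \<in> {\<omega> \<in> space (P x). X 0 \<omega> = x} \<inter>
             {\<omega> \<in> space (P x). \<forall>i\<le>n. X (t + ts i) \<omega> = l ! i})"
        using random_walk_start[OF rw, of x] by eventually_elim blast
    qed
    also have "\<dots> = (\<Prod>i<Suc n. measure (P (?ys i))
                  {\<omega> \<in> space (P (?ys i)). X (?ts (Suc i) - ?ts i) \<omega> = ?ys (Suc i)})"
      using t ts by (intro random_walk_fdd[OF rw]) (auto simp: ts0 split: nat.splits)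
    also have "\<dots> = measure (P x) {\<omega> \<in> space (P x). X t \<omega> = l ! 0} *
        (\<Prod>i<n. measure (P (l ! i)) {\<omega> \<in> space (P (l ! i)). X (ts (Suc i) - ts i) \<omega> = l ! Suc i})"
      unfolding prod.lessThan_Suc_shift by (simp add: ts0)
    also have "(\<Prod>i<n. measure (P (l ! i)) {\<omega> \<in> space (P (l ! i)). X (ts (Suc i) - ts i) \<omega> = l ! Suc i})
        = measure (P (l ! 0)) {\<omega> \<in> space (P (l ! 0)). \<forall>i\<le>n. X (ts i) \<omega> = l ! i}"
      using ts by (intro random_walk_fdd[OF rw, symmetric]) (auto simp: ts0)
    finally have eq: "measure (P x) {\<omega> \<in> space (P x). \<forall>i\<le>n. X (t + ts i) \<omega> = l ! i} =
       measure (P x) {\<omega> \<in> space (P x). X t \<omega> = l ! 0} *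
       measure (P (l ! 0)) {\<omega> \<in> space (P (l ! 0)). \<forall>i\<le>n. X (ts i) \<omega> = l ! i}" .
    have preX: "X t -` {l ! 0} \<inter> space (P x) = {\<omega> \<in> space (P x). X t \<omega> = l ! 0}" by auto
    show ?thesis
      unfolding hd
      by (subst (1 2 3) emeasure_distr)
         (simp_all add: pre preX P.emeasure_eq_measure eq ennreal_mult mult.commute)
  qed
  show ?thesis
  proof (rule measure_eqI_countable[of _ UNIV])
    show "sets (Giry_Monad.bind ?D ?N) = Pow UNIV"
      by (subst sets_bind[where N="count_space UNIV"]) auto
    fix l :: "'v list"
    have "emeasure (Giry_Monad.bind ?D ?N) {l} = (\<integral>\<^sup>+y. emeasure (?N y) {l} \<partial>?D)"
      by (intro emeasure_bind[OF _ N]) auto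
    also have "\<dots> = (\<integral>\<^sup>+y. emeasure (?N (hd l)) {l} * indicator {hd l} y \<partial>?D)"
      using N_start by (intro nn_integral_cong) (auto simp: indicator_def)
    also have "\<dots> = emeasure (?N (hd l)) {l} * emeasure ?D {hd l}"
      by (intro nn_integral_cmult_indicator) simp
    finally show "emeasure ?L {l} = emeasure (Giry_Monad.bind ?D ?N) {l}"
      using * by simp
  qed (auto)
qed

lemma hitting_measurable:
  assumes rw: "random_walk p P X" and D: "countable D" "\<And>s. s \<in> D \<Longrightarrow> 0 \<le> s" and t: "0 \<le> t"
  shows "{\<omega> \<in> space (P x). \<exists>s\<in>D. X (t + s) \<omega> = v} \<in> sets (P x)"
  using D t by (intro sets.sets_Collect_countable_Ex' random_walk_at_measurable[OF rw]) auto

text \<open>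
Whether the walk hits \<open>v\<close> at one of finitely many times can be read off the list of its positions at
these times, whose law is known from the Markov property for finite paths.
\<close>

lemma hitting_shift_finite:
  fixes P :: "'v::countable \<Rightarrow> 'w measure"
  assumes rw: "random_walk p P X" and F: "finite F" "0 \<in> F" "\<And>s. s \<in> F \<Longrightarrow> 0 \<le> s" and t: "0 < t"
  shows "emeasure (P x) {\<omega> \<in> space (P x). \<exists>s\<in>F. X (t + s) \<omega> = v} =
    (\<integral>\<^sup>+\<omega>. emeasure (P (X t \<omega>)) {\<omega>' \<in> space (P (X t \<omega>)). \<exists>s\<in>F. X s \<omega>' = v} \<partial>P x)"
proof -
  interpret P: prob_space "P y" for y by (rule random_walk_prob_space[OF rw])
  \<comment> \<open>the times of \<open>F\<close> in increasing order; the first one is 0 since \<open>0 \<in> F\<close>\<close>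
  define ts where "ts i = sorted_list_of_set F ! i" for i
  define n where "n = card F - 1"
  have card: "card F = Suc n" using F(1,2) by (cases "card F") (auto simp: n_def)
  have len: "length (sorted_list_of_set F) = Suc n" using card by simp
  have set_ts: "ts ` {..n} = F"
  proof -
    have "F = set (sorted_list_of_set F)" using F(1) by simp
    also have "\<dots> = ts ` {..n}"
      unfolding set_conv_nth len by (auto simp: ts_def less_Suc_eq_le)
    finally show ?thesis ..
  qed
  have mono: "ts i < ts j" if "i < j" "j \<le> n" for i j
    unfolding ts_def using that len strict_sorted_list_of_set[of F]
    by (intro sorted_wrt_nth_less[of "(<)"]) auto
  have "ts 0 \<le> 0"
  proof -
    obtain i where "i \<le> n" "ts i = 0" using F(2) set_ts by (metis atMost_iff imageE)
    then show ?thesis using mono[of 0 i] by (cases i) auto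
  qed
  moreover have "0 \<le> ts 0" using set_ts by (intro F(3)) auto
  ultimately have ts0: "ts 0 = 0" by simp
  have nn: "0 \<le> ts i" if "i \<le> n" for i using set_ts that by (intro F(3)) auto
  let ?path = "\<lambda>t \<omega>. map (\<lambda>i. X (t + ts i) \<omega>) [0..<Suc n]"
  have hit: "(\<exists>s\<in>F. X (r + s) \<omega> = v) \<longleftrightarrow> v \<in> set (?path r \<omega>)" for r \<omega>
    unfolding set_ts[symmetric] by (auto simp: less_Suc_eq_le simp del: upt_Suc)
  have Xt: "X t \<in> P x \<rightarrow>\<^sub>M count_space UNIV"
    using random_walk_measurable[OF rw] t by simp
  have pm: "?path r \<in> P y \<rightarrow>\<^sub>M count_space UNIV" if "0 \<le> r" for y r
    using nn that by (intro path_measurable[OF rw]) auto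
  let ?A = "{l. v \<in> set l}" and ?C = "count_space UNIV"
  have pre: "{\<omega> \<in> space (P y). \<exists>s\<in>F. X (r + s) \<omega> = v} = ?path r -` ?A \<inter> space (P y)" for r y
    unfolding hit by auto
  have law: "emeasure (P y) {\<omega> \<in> space (P y). \<exists>s\<in>F. X (r + s) \<omega> = v} =
      emeasure (distr (P y) ?C (?path r)) ?A" if "0 \<le> r" for r y
    unfolding pre by (rule emeasure_distr[OF pm[OF that], symmetric]) simp
  have N: "(\<lambda>y. distr (P y) ?C (?path 0)) \<in> distr (P x) ?C (X t) \<rightarrow>\<^sub>M subprob_algebra ?C"
    using pm[of 0]
    by (auto simp: space_subprob_algebra intro!: prob_space_imp_subprob_space P.prob_space_distr)
  have "emeasure (P x) {\<omega> \<in> space (P x). \<exists>s\<in>F. X (t + s) \<omega> = v} =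
      emeasure (distr (P x) ?C (?path t)) ?A"
    using t by (intro law) simp
  also have "distr (P x) ?C (?path t) =
      Giry_Monad.bind (distr (P x) ?C (X t)) (\<lambda>y. distr (P y) ?C (?path 0))"
    using path_shift_distr[of p P X ts n t x] rw ts0 mono t by simp
  also have "emeasure \<dots> ?A = (\<integral>\<^sup>+y. emeasure (distr (P y) ?C (?path 0)) ?A \<partial>distr (P x) ?C (X t))"
    by (rule emeasure_bind[OF _ N]) auto
  also have "\<dots> = (\<integral>\<^sup>+\<omega>. emeasure (distr (P (X t \<omega>)) ?C (?path 0)) ?A \<partial>P x)"
    by (intro nn_integral_distr[OF Xt]) simp
  also have "\<dots> = (\<integral>\<^sup>+\<omega>. emeasure (P (X t \<omega>)) {\<omega>' \<in> space (P (X t \<omega>)). \<exists>s\<in>F. X (0 + s) \<omega>' = v} \<partial>P x)"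
    using law[of 0] by simp
  finally show ?thesis by simp
qed

text \<open>
Exhausting \<open>D\<close> by finite sets, the Markov property passes to the limit by monotone convergence.
\<close>

lemma hitting_shift:
  fixes P :: "'v::countable \<Rightarrow> 'w measure"
  assumes rw: "random_walk p P X" and D: "countable D" "0 \<in> D" "\<And>s. s \<in> D \<Longrightarrow> 0 \<le> s" and t: "0 < t"
  shows "emeasure (P x) {\<omega> \<in> space (P x). \<exists>s\<in>D. X (t + s) \<omega> = v} =
    (\<integral>\<^sup>+\<omega>. emeasure (P (X t \<omega>)) {\<omega>' \<in> space (P (X t \<omega>)). \<exists>s\<in>D. X s \<omega>' = v} \<partial>P x)"
proof -
  define F where "F n = insert 0 (from_nat_into D ` {..n})" for n :: nat
  have F: "finite (F n)" "0 \<in> F n" "F n \<subseteq> D" for n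
    using D(2) from_nat_into[of D] by (auto simp: F_def)
  have F_nn: "0 \<le> s" if "s \<in> F n" for s n using F(3) that D(3) by blast
  have F_mono: "F m \<subseteq> F n" if "m \<le> n" for m n using that by (auto simp: F_def)
  have UF: "(\<Union>n. F n) = D"
    using F(3) D(1,2) by (auto simp: F_def) (metis from_nat_into_surj image_eqI atMost_iff order_refl)
  have Xt: "X t \<in> P x \<rightarrow>\<^sub>M count_space UNIV"
    using random_walk_measurable[OF rw] t by simp
  let ?E = "\<lambda>D r y. {\<omega> \<in> space (P y). \<exists>s\<in>D. X (r + s) \<omega> = v}"
  have E_meas: "?E (F n) r y \<in> sets (P y)" if "0 \<le> r" for n r y
    by (rule hitting_measurable[OF rw countable_finite[OF F(1)] F_nn that])
  have SUP: "(SUP n. emeasure (P y) (?E (F n) r y)) = emeasure (P y) (?E D r y)" if "0 \<le> r" for r y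
  proof -
    have "(SUP n. emeasure (P y) (?E (F n) r y)) = emeasure (P y) (\<Union>n. ?E (F n) r y)"
    proof (rule SUP_emeasure_incseq)
      show "range (\<lambda>n. ?E (F n) r y) \<subseteq> sets (P y)"
        using E_meas[OF that] by blast
      show "incseq (\<lambda>n. ?E (F n) r y)"
        using F_mono by (fastforce simp: incseq_def)
    qed
    also have "(\<Union>n. ?E (F n) r y) = ?E D r y" unfolding UF[symmetric] by auto
    finally show ?thesis .
  qed
  have inc: "incseq (\<lambda>n. emeasure (P y) (?E (F n) 0 y))" for y
    using F_mono by (intro monoI emeasure_mono E_meas order_refl) blast
  have m: "(\<lambda>\<omega>. f (X t \<omega>)) \<in> borel_measurable (P x)" for f :: "'v \<Rightarrow> ennreal"
    by (rule measurable_compose[OF Xt]) simp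
  have "emeasure (P x) (?E D t x) = (SUP n. emeasure (P x) (?E (F n) t x))"
    using SUP[of t x] t by simp
  also have "\<dots> = (SUP n. \<integral>\<^sup>+\<omega>. emeasure (P (X t \<omega>)) (?E (F n) 0 (X t \<omega>)) \<partial>P x)"
    using hitting_shift_finite[OF rw F(1,2) F_nn t] by simp
  also have "\<dots> = (\<integral>\<^sup>+\<omega>. (SUP n. emeasure (P (X t \<omega>)) (?E (F n) 0 (X t \<omega>))) \<partial>P x)"
    using inc by (intro nn_integral_monotone_convergence_SUP[symmetric] m)
      (auto simp: incseq_def le_fun_def)
  also have "\<dots> = (\<integral>\<^sup>+\<omega>. emeasure (P (X t \<omega>)) (?E D 0 (X t \<omega>)) \<partial>P x)"
    using SUP[of 0] by (simp cong: nn_integral_cong)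
  finally show ?thesis by simp
qed

text \<open>
By right-continuity of the path a visit lasts for a positive time. Hence hitting probabilities
involve only countably many times.
\<close>

lemma visit_at_rational_time:
  assumes rw: "random_walk p P X" and \<omega>: "\<omega> \<in> space (P x)" and t: "0 \<le> t" "X t \<omega> = v"
  shows "\<exists>s\<in>{s\<in>\<rat>. 0 \<le> s}. X s \<omega> = v"
proof -
  have "\<forall>\<^sub>F s in at_right t. X s \<omega> = v"
    using random_walk_right_continuous[OF rw \<omega> t(1)] t(2) by simp
  then obtain b where b: "t < b" "\<And>s. t < s \<Longrightarrow> s < b \<Longrightarrow> X s \<omega> = v"
    unfolding eventually_at_right_field by auto
  obtain q where "q \<in> \<rat>" "t < q" "q < b" using Rats_dense_in_real[OF b(1)] by auto
  with b(2) t(1) show ?thesis by force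
qed

text \<open>
The function is the probability of ever visiting \<open>v\<close>. By the Markov property its expectation at time
\<open>t\<close> is the probability of a visit after \<open>t\<close>, which is at most the probability of a visit at all; this
makes the generator nonpositive. If the function were identically 1 there would almost surely be
visits after every time, contradicting transience.
\<close>

lemma transient_excessive_function:
  fixes P :: "'v::countable \<Rightarrow> 'w measure"
  assumes rw: "random_walk p P X" and tr: "transient_walk P X"
  shows "\<exists>h. (\<forall>x. 0 \<le> h x \<and> h x \<le> 1) \<and> h v = 1 \<and> (\<forall>x. rw_generator p h x \<le> 0) \<and>
    (\<exists>x. h x < (1::real))"
proof -
  interpret P: prob_space "P y" for y by (rule random_walk_prob_space[OF rw])
  define D :: "real set" where "D = {s\<in>\<rat>. 0 \<le> s}"
  have D: "countable D" "0 \<in> D" "\<And>s. s \<in> D \<Longrightarrow> 0 \<le> s"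
    by (auto simp: D_def intro: countable_subset[OF _ countable_rat])
  let ?E = "\<lambda>t y. {\<omega> \<in> space (P y). \<exists>s\<in>D. X (t + s) \<omega> = v}"
  define h where "h x = measure (P x) (?E 0 x)" for x
  have E: "?E t x \<in> sets (P x)" if "0 \<le> t" for t x
    using that D by (intro hitting_measurable[OF rw]) auto
  have h: "0 \<le> h x" "h x \<le> 1" for x by (auto simp: h_def)
  have hv: "h v = 1"
    unfolding h_def
  proof (rule P.prob_eq_1[THEN iffD2, OF E[OF order_refl]])
    show "AE \<omega> in P v. \<omega> \<in> ?E 0 v"
      using random_walk_start[OF rw, of v] AE_space
      by eventually_elim (use D(2) in force)
  qed
  have shift: "(\<integral>\<omega>. h (X t \<omega>) \<partial>P x) = measure (P x) (?E t x)" if t: "0 < t" for t x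
  proof -
    have Xt: "X t \<in> P x \<rightarrow>\<^sub>M count_space UNIV"
      using random_walk_measurable[OF rw] t by simp
    have "(\<integral>\<omega>. h (X t \<omega>) \<partial>P x) = enn2real (\<integral>\<^sup>+\<omega>. ennreal (h (X t \<omega>)) \<partial>P x)"
      by (intro integral_eq_nn_integral measurable_compose[OF Xt]) (auto simp: h)
    also have "(\<integral>\<^sup>+\<omega>. ennreal (h (X t \<omega>)) \<partial>P x) = emeasure (P x) (?E t x)"
      using hitting_shift[OF rw D t] by (simp add: h_def P.emeasure_eq_measure)
    finally show ?thesis by (simp add: measure_def)
  qed
  have le: "measure (P x) (?E t x) \<le> h x" if "0 < t" for t x
    unfolding h_def
  proof (rule P.finite_measure_mono[OF _ E[OF order_refl]])
    show "?E t x \<subseteq> ?E 0 x"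
    proof
      fix \<omega> assume "\<omega> \<in> ?E t x"
      then obtain s where s: "\<omega> \<in> space (P x)" "s \<in> D" "X (t + s) \<omega> = v" by blast
      then have "0 \<le> t + s" using that D(3)[of s] by simp
      from visit_at_rational_time[OF rw s(1) this s(3)] s(1) show "\<omega> \<in> ?E 0 x"
        unfolding D_def add_0 by blast
    qed
  qed
  have gen: "rw_generator p h x \<le> 0" for x
  proof (rule tendsto_upperbound)
    have "bounded (range h)" using h by (auto simp: bounded_iff intro!: exI[of _ 1])
    from random_walk_generator[OF rw this]
    show "((\<lambda>t. ((\<integral>\<omega>. h (X t \<omega>) \<partial>P x) - h x) / t) \<longlongrightarrow> rw_generator p h x) (at_right 0)"
      by (rule tendsto_uniform_limitI) simp
    show "\<forall>\<^sub>F t in at_right 0. ((\<integral>\<omega>. h (X t \<omega>) \<partial>P x) - h x) / t \<le> 0"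
      using eventually_at_right_less[of 0]
      by eventually_elim (use shift le in \<open>simp add: divide_le_0_iff\<close>)
  qed simp
  have "\<exists>x. h x < 1"
  proof (rule ccontr)
    assume "\<nexists>x. h x < 1"
    then have h1: "h x = 1" for x using h(2)[of x] by (meson antisym_conv2)
    have "measure (P v) (?E t v) = 1" if "0 < t" for t
      using shift[OF that, of v] by (simp add: h1 P.prob_space)
    then have "AE \<omega> in P v. \<omega> \<in> ?E (real (Suc n)) v" for n
      using P.prob_eq_1[OF E[of "real (Suc n)" v]] by simp
    then have "AE \<omega> in P v. \<forall>n. \<omega> \<in> ?E (real (Suc n)) v"
      by (simp add: AE_all_countable)
    moreover have "AE \<omega> in P v. bounded {t. 0 \<le> t \<and> X t \<omega> = v}"
      using tr unfolding transient_walk_def by blast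
    ultimately have "AE \<omega> in P v. False"
    proof eventually_elim
      case (elim \<omega>)
      then obtain B where B: "\<And>t. 0 \<le> t \<Longrightarrow> X t \<omega> = v \<Longrightarrow> \<bar>t\<bar> \<le> B"
        unfolding bounded_iff by auto
      obtain n where n: "B < real n" using reals_Archimedean2 by blast
      obtain s where "s \<in> D" "X (real (Suc n) + s) \<omega> = v" using elim by blast
      with B[of "real (Suc n) + s"] D(3)[of s] n show False by simp
    qed
    then show False by simp
  qed
  then show ?thesis using h hv gen by blast
qed

section \<open>Product measures\<close>

lemma integral_vacant_product:
  fixes q :: "'v \<Rightarrow> bool pmf"
  assumes A: "finite A"
  shows "(\<integral>\<eta>. vacant A \<eta> \<partial>Pi\<^sub>M UNIV (\<lambda>x. measure_pmf (q x))) = (\<Prod>x\<in>A. pmf (q x) False)"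
proof -
  let ?M = "Pi\<^sub>M UNIV (\<lambda>x. measure_pmf (q x))"
  interpret product_prob_space "\<lambda>x. measure_pmf (q x)" UNIV
    by unfold_locales
  let ?Z = "{\<eta> \<in> space ?M. \<forall>x\<in>A. \<eta> x \<in> {False}}"
  have "(\<integral>\<eta>. vacant A \<eta> \<partial>?M) = (\<integral>\<eta>. indicator ?Z \<eta> \<partial>?M)"
    by (intro Bochner_Integration.integral_cong) (auto simp: vacant_def indicator_def space_PiM)
  also have "\<dots> = measure ?M ?Z"
    by (simp add: Int_absorb2 Collect_restrict)
  also have "\<dots> = (\<Prod>x\<in>A. pmf (q x) False)"
    unfolding measure_def
    by (subst emeasure_PiM_Collect) (use A in \<open>auto simp: emeasure_pmf_single prod_ennreal prod_nonneg\<close>)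
  finally show ?thesis .
qed

lemma product_law:
  fixes q :: "'v \<Rightarrow> bool pmf"
  shows "prob_space (Pi\<^sub>M UNIV (\<lambda>x. measure_pmf (q x)))"
    and "sets (Pi\<^sub>M UNIV (\<lambda>x. measure_pmf (q x))) = sets config_space"
  unfolding config_space_def
  by (auto intro!: prob_space_PiM prob_space_measure_pmf sets_PiM_cong)

text \<open>
Two independent walkers would give the first two summands. Exclusion suppresses the jumps between \<open>x\<close>
and \<open>y\<close>, which for a product would contribute the square.
\<close>

lemma product_pair_identity:
  fixes g :: "'v \<Rightarrow> real"
  assumes p: "irreducible_symmetric_rates p" and g: "\<And>x. \<bar>g x\<bar> \<le> 1"
    and W: "\<And>A. finite A \<Longrightarrow> W A = (\<Prod>x\<in>A. g x)"
    and xy: "x \<noteq> y"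
  shows "hole_generator p lam v0 W {x, y} =
    g y * hole_generator p lam v0 W {x} + g x * hole_generator p lam v0 W {y} - p x y * (g x - g y)\<^sup>2"
proof -
  define L where "L x = (\<Sum>\<^sub>\<infinity>z. p x z * (g z - g x))" for x
  have W1: "W {a} = g a" for a using W[of "{a}"] by simp
  have Q1: "hole_generator p lam v0 W {a} = L a - lam * of_bool (v0 = a) * g a" for a
    unfolding hole_generator_def L_def by (simp add: W1) (intro infsum_cong, auto)
  have row: "(\<Sum>\<^sub>\<infinity>z. p a z * (of_bool (z \<notin> {a, b}) * (W {z, b} - W {a, b}))) =
      g b * (L a - p a b * (g b - g a))" if ab: "a \<noteq> b" for a b
  proof -
    have s: "((\<lambda>z. p a z * (g z - g a)) has_sum L a) UNIV"
    unfolding L_def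
    proof (rule has_sum_infsum, rule rates_summable_bounded[OF p])
      show "\<bar>g z - g a\<bar> \<le> 2" for z using g[of z] g[of a] by linarith
    qed
    \<comment> \<open>the row with the suppressed jump removed; the term \<open>z = a\<close> vanishes by itself\<close>
    have "((\<lambda>z. of_bool (z = b) * (p a z * (g z - g a))) has_sum p a b * (g b - g a)) UNIV"
      by (subst has_sum_cong_neutral[where T = "{b}"])
        (auto simp: has_sum_finite_iff)
    from has_sum_cmult_right[OF has_sum_minus[OF s this], of "g b"]
    have "((\<lambda>z. p a z * (of_bool (z \<notin> {a, b}) * (W {z, b} - W {a, b}))) has_sum
        g b * (L a - p a b * (g b - g a))) UNIV"
      by (rule has_sum_cong[THEN iffD1, rotated])
        (use ab in \<open>auto simp: W algebra_simps\<close>)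
    then show ?thesis by (rule infsumI)
  qed
  have "hole_generator p lam v0 W {x, y} =
      (\<Sum>\<^sub>\<infinity>z. p x z * (of_bool (z \<notin> {x, y}) * (W {z, y} - W {x, y}))) +
      (\<Sum>\<^sub>\<infinity>z. p y z * (of_bool (z \<notin> {y, x}) * (W {z, x} - W {y, x}))) -
      lam * of_bool (v0 \<in> {x, y}) * W {x, y}"
    unfolding hole_generator_def using xy by (simp add: insert_commute insert_Diff_if)
  also have "\<dots> = g y * (L x - p x y * (g y - g x)) + g x * (L y - p x y * (g x - g y)) -
      lam * of_bool (v0 \<in> {x, y}) * (g x * g y)"
    using xy row[of x y] row[of y x] rates_sym[OF p, of y x] by (simp add: W)
  also have "lam * of_bool (v0 \<in> {x, y}) * (g x * g y) =
      g y * (lam * of_bool (v0 = x) * g x) + g x * (lam * of_bool (v0 = y) * g y)"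
    using xy by auto
  finally have expand: "hole_generator p lam v0 W {x, y} =
      g y * (L x - p x y * (g y - g x)) + g x * (L y - p x y * (g x - g y)) -
      (g y * (lam * of_bool (v0 = x) * g x) + g x * (lam * of_bool (v0 = y) * g y))" .
  have ring: "b * (l - r * (b - a)) + a * (m - r * (a - b)) - (b * c + a * d) =
      b * (l - c) + a * (m - d) - r * (a - b)\<^sup>2" for a b c d l m r :: real
    by (simp add: algebra_simps power2_eq_square)
  show ?thesis
    unfolding Q1 expand by (rule ring)
qed

section \<open>The exclusion process with a source\<close>

locale sep_source = feller K for K :: "real \<Rightarrow> ('v::countable \<Rightarrow> bool) \<Rightarrow> ('v \<Rightarrow> bool) measure" +
  fixes p :: "'v \<Rightarrow> 'v \<Rightarrow> real" and v0 :: 'v and lam :: real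
  assumes rates: "irreducible_symmetric_rates p"
    and lam_pos: "0 < lam"
    and semigroup: "sep_source_semigroup p lam v0 K"
begin

abbreviation Q :: "('v set \<Rightarrow> real) \<Rightarrow> 'v set \<Rightarrow> real" where
  "Q \<equiv> hole_generator p lam v0"

abbreviation hole_prob :: "('v \<Rightarrow> bool) measure \<Rightarrow> 'v set \<Rightarrow> real" where
  "hole_prob \<nu> A \<equiv> \<integral>\<eta>. vacant A \<eta> \<partial>\<nu>"

lemma hole_prob_bounds:
  assumes "prob_space \<nu>"
  shows "0 \<le> hole_prob \<nu> A" "hole_prob \<nu> A \<le> 1"
proof -
  interpret prob_space \<nu> by fact
  show "0 \<le> hole_prob \<nu> A" by (rule integral_nonneg_AE) (simp add: vacant_bounds)
  show "hole_prob \<nu> A \<le> 1"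
  proof (cases "integrable \<nu> (vacant A)")
    case True
    then show ?thesis by (rule integral_le_const) (simp add: vacant_bounds)
  qed (simp add: not_integrable_integral_eq)
qed

lemma vacant_continuous: "finite A \<Longrightarrow> continuous_on UNIV (vacant A)"
  by (rule local_function_continuous[OF vacant_local])

lemma vacant_generates:
  assumes "finite A"
  shows "generates (vacant A) (\<lambda>\<eta>. Q (\<lambda>B. vacant B \<eta>) A)"
proof -
  have "uniform_limit UNIV (\<lambda>t \<eta>. ((\<integral>\<zeta>. vacant A \<zeta> \<partial>K t \<eta>) - vacant A \<eta>) / t)
      (sep_source_generator p lam v0 (vacant A)) (at_right 0)"
    using semigroup vacant_local[OF assms] unfolding sep_source_semigroup_def by blast
  moreover have "sep_source_generator p lam v0 (vacant A) = (\<lambda>\<eta>. Q (\<lambda>B. vacant B \<eta>) A)"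
    using generator_vacant[OF rates assms] by blast
  ultimately show ?thesis
    unfolding generates_def using vacant_continuous[OF assms] by simp
qed

context
  fixes \<nu> assumes law: "prob_space \<nu>" "sets \<nu> = sets (config_space :: ('v \<Rightarrow> bool) measure)"
begin

lemma hole_prob_evolve_bounds:
  assumes "0 \<le> t"
  shows "0 \<le> hole_prob (evolve \<nu> t) A" "hole_prob (evolve \<nu> t) A \<le> 1" "\<bar>hole_prob (evolve \<nu> t) A\<bar> \<le> 1"
  using hole_prob_bounds[OF evolve_law(1)[OF law assms], of A] by simp_all

lemma hole_prob_evolve_0: "finite A \<Longrightarrow> hole_prob (evolve \<nu> 0) A = hole_prob \<nu> A"
  by (rule evolve_0[OF law vacant_continuous])

lemma hole_prob_evolve_add:
  assumes "0 \<le> s" "0 \<le> t" "finite A"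
  shows "hole_prob (evolve \<nu> (s + t)) A = hole_prob (evolve (evolve \<nu> s) t) A"
  using evolve_add[OF law assms(1,2) vacant_continuous[OF assms(3)]]
    evolve_integral[OF evolve_law[OF law assms(1)] assms(2) vacant_continuous[OF assms(3)]] by simp

lemma hole_prob_has_derivative:
  assumes "finite A" "0 \<le> t"
  shows "((\<lambda>t. hole_prob (evolve \<nu> t) A) has_real_derivative Q (hole_prob (evolve \<nu> t)) A)
    (at t within {0..})"
  using evolve_has_derivative[OF law vacant_generates[OF assms(1)] assms(2)]
  unfolding integral_hole_generator[OF rates evolve_law[OF law assms(2)] assms(1)] .

end

text \<open>
The dual form of attractiveness, restricted to hole probabilities.
\<close>

lemma hole_prob_comparison:
  assumes \<nu>: "prob_space \<nu>" "sets \<nu> = sets config_space"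
    and \<nu>': "prob_space \<nu>'" "sets \<nu>' = sets config_space"
    and le: "\<And>B. finite B \<Longrightarrow> hole_prob \<nu> B \<le> hole_prob \<nu>' B"
    and A: "finite A" and t: "0 \<le> t"
  shows "hole_prob (evolve \<nu> t) A \<le> hole_prob (evolve \<nu>' t) A"
proof -
  let ?u = "\<lambda>t A. hole_prob (evolve \<nu>' t) A - hole_prob (evolve \<nu> t) A"
  have "0 \<le> ?u t A"
  proof (rule hole_comparison[OF rates less_imp_le[OF lam_pos], where u = ?u and C = 2
        and n = "card A" and t = t and A = A
        and u' = "\<lambda>t A. Q (hole_prob (evolve \<nu>' t)) A - Q (hole_prob (evolve \<nu> t)) A"])
    fix t :: real and B :: "'v set" assume t: "0 \<le> t"
    note b = hole_prob_evolve_bounds[OF \<nu> t] hole_prob_evolve_bounds[OF \<nu>' t]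
    show "\<bar>?u t B\<bar> \<le> 2"
      using b(1,2,4,5)[of B] by linarith
    assume B: "finite B"
    show "((\<lambda>t. ?u t B) has_real_derivative Q (hole_prob (evolve \<nu>' t)) B - Q (hole_prob (evolve \<nu> t)) B)
        (at t within {0..})"
      by (intro DERIV_diff hole_prob_has_derivative \<nu> \<nu>' B t)
    show "Q (?u t) B \<le> Q (hole_prob (evolve \<nu>' t)) B - Q (hole_prob (evolve \<nu> t)) B"
      using hole_generator_diff[OF rates b(6) b(3)] by simp
  next
    show "0 \<le> ?u 0 B" if "finite B" for B
      using le[OF that] hole_prob_evolve_0[OF \<nu> that] hole_prob_evolve_0[OF \<nu>' that] by simp
  qed (use A t in auto)
  then show ?thesis by simp
qed

text \<open>
By the Markov property and comparison, if hole probabilities never exceed their initial values, they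
decrease in time, and so they converge.
\<close>

lemma weak_limit_exists_if_never_above_initial:
  assumes \<nu>: "prob_space \<nu>" "sets \<nu> = sets config_space"
    and le: "\<And>t B. 0 \<le> t \<Longrightarrow> finite B \<Longrightarrow> hole_prob (evolve \<nu> t) B \<le> hole_prob \<nu> B"
  shows "\<exists>\<mu>. weak_limit (evolve \<nu>) \<mu>"
proof (rule weak_limit_if_local_integrals_converge)
  show "prob_space (evolve \<nu> t)" "sets (evolve \<nu> t) = sets config_space" if "0 \<le> t" for t
    by (rule evolve_law[OF \<nu> that])+
  fix f :: "('v \<Rightarrow> bool) \<Rightarrow> real" assume f: "local_function f"
  have ev: "\<forall>\<^sub>F t in at_top. (0::real) \<le> t" by (rule eventually_ge_at_top)
  show "\<exists>l. ((\<lambda>t. \<integral>\<eta>. f \<eta> \<partial>evolve \<nu> t) \<longlongrightarrow> l) at_top"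
  proof (rule integral_local_converges[OF _ _ f])
    show "\<forall>\<^sub>F t in at_top. prob_space (evolve \<nu> t) \<and> sets (evolve \<nu> t) = sets config_space"
      using ev by eventually_elim (simp add: evolve_law[OF \<nu>])
    fix A :: "'v set" assume A: "finite A"
    \<comment> \<open>frozen at negative times and negated, to be monotone on the whole line\<close>
    define w where "w t = - hole_prob (evolve \<nu> (max 0 t)) A" for t
    have mono: "mono w"
    proof (rule monoI)
      fix s t :: real assume "s \<le> t"
      then have st: "0 \<le> max 0 s" "0 \<le> max 0 t - max 0 s" by auto
      have "hole_prob (evolve \<nu> (max 0 t)) A =
          hole_prob (evolve \<nu> ((max 0 t - max 0 s) + max 0 s)) A" by simp
      also have "\<dots> = hole_prob (evolve (evolve \<nu> (max 0 t - max 0 s)) (max 0 s)) A"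
        by (rule hole_prob_evolve_add[OF \<nu> st(2,1) A])
      also have "\<dots> \<le> hole_prob (evolve \<nu> (max 0 s)) A"
        by (rule hole_prob_comparison[OF evolve_law[OF \<nu> st(2)] \<nu> le[OF st(2)] A st(1)])
      finally show "w s \<le> w t" by (simp add: w_def)
    qed
    have "incseq (\<lambda>n. w (real n))"
      using mono by (auto simp: incseq_def mono_def)
    moreover have "w (real n) \<le> 0" for n
      using hole_prob_evolve_bounds(1)[OF \<nu>, of "max 0 (real n)" A] by (simp add: w_def)
    ultimately obtain l where "(\<lambda>n. w (real n)) \<longlonglongrightarrow> l"
      using incseq_convergent[of "\<lambda>n. w (real n)" 0] by blast
    then have "(w \<longlongrightarrow> l) at_top"
      by (rule tendsto_at_topI_sequentially_real[OF mono])
    then have "((\<lambda>t. - w t) \<longlongrightarrow> - l) at_top" by (rule tendsto_minus)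
    then have "((\<lambda>t. hole_prob (evolve \<nu> t) A) \<longlongrightarrow> - l) at_top"
    proof (rule Lim_transform_eventually)
      show "\<forall>\<^sub>F t in at_top. - w t = hole_prob (evolve \<nu> t) A"
        using ev by eventually_elim (simp add: w_def)
    qed
    then show "\<exists>l. ((\<lambda>t. hole_prob (evolve \<nu> t) A) \<longlongrightarrow> l) at_top" by blast
  qed
qed

context
  fixes \<rho> :: real
  assumes \<rho>: "0 < \<rho>" "\<rho> < 1"
begin

lemma bernoulli_law:
  "prob_space (bernoulli_product \<rho>)"
  "sets (bernoulli_product \<rho>) = sets (config_space :: ('v \<Rightarrow> bool) measure)"
  unfolding bernoulli_product_def by (rule product_law)+

lemma hole_prob_bernoulli: "finite B \<Longrightarrow> hole_prob (bernoulli_product \<rho>) B = (1 - \<rho>) ^ card B"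
  unfolding bernoulli_product_def using \<rho> by (simp add: integral_vacant_product)

text \<open>
For a Bernoulli law the hole probabilities are constant on the sets of a given size, so the exclusion
part of \<open>Q\<close> annihilates them and only the killing part remains: the constant is a supersolution.
\<close>

lemma hole_prob_bernoulli_le:
  assumes t: "0 \<le> t" and A: "finite A"
  shows "hole_prob (evolve (bernoulli_product \<rho>) t) A \<le> hole_prob (bernoulli_product \<rho>) A"
proof -
  note \<nu> = bernoulli_law
  define c where "c = (1 - \<rho>) ^ card A"
  have c: "0 \<le> c" "c \<le> 1" using \<rho> by (auto simp: c_def intro: power_le_one)
  let ?w = "\<lambda>t. hole_prob (evolve (bernoulli_product \<rho>) t)"
  let ?u = "\<lambda>t A. c - ?w t A"
  have "0 \<le> ?u t A"
  proof (rule hole_comparison[OF rates less_imp_le[OF lam_pos], where u = ?u and C = 2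
        and n = "card A" and t = t and A = A and u' = "\<lambda>t A. 0 - Q (?w t) A"])
    fix t :: real and B :: "'v set" assume t: "0 \<le> t"
    note b = hole_prob_evolve_bounds[OF \<nu> t]
    show "\<bar>?u t B\<bar> \<le> 2" using b(1,2)[of B] c by linarith
    assume B: "finite B"
    show "((\<lambda>t. ?u t B) has_real_derivative 0 - Q (?w t) B) (at t within {0..})"
      by (intro DERIV_diff DERIV_const hole_prob_has_derivative \<nu> B t)
    have "Q (?u t) B = Q (\<lambda>_. c) B - Q (?w t) B"
      using b(3) c by (intro hole_generator_diff[OF rates, where C = 1]) auto
    moreover have "Q (\<lambda>_. c) B \<le> 0"
      using c lam_pos by (simp add: hole_generator_def)
    ultimately show "Q (?u t) B \<le> 0 - Q (?w t) B" by simp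
  next
    show "0 \<le> ?u 0 B" if "finite B" "card B = card A" for B
      using that hole_prob_evolve_0[OF \<nu> that(1)] by (simp add: hole_prob_bernoulli c_def)
  qed (use A t in auto)
  then show ?thesis by (simp add: hole_prob_bernoulli[OF A] c_def)
qed

text \<open>
On singletons \<open>(1 - \<rho>) * (1 - h x)\<close> is a subsolution: the random walk part is nonnegative as \<open>h\<close> is
excessive, and the killing term vanishes because \<open>h v0 = 1\<close>.
\<close>

lemma hole_prob_bernoulli_ge:
  assumes h: "\<And>x. 0 \<le> h x" "\<And>x. h x \<le> 1" "h v0 = 1" "\<And>x. rw_generator p h x \<le> 0" and t: "0 \<le> t"
  shows "(1 - \<rho>) * (1 - h x) \<le> hole_prob (evolve (bernoulli_product \<rho>) t) {x}"
proof -
  note \<nu> = bernoulli_law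
  \<comment> \<open>the subsolution, regarded as a function of singletons\<close>
  define F where "F A = (1 - \<rho>) * (1 - h (the_elem A))" for A
  have F: "0 \<le> F A" "F A \<le> 1 - \<rho>" "\<bar>F A\<bar> \<le> 1" for A
  proof -
    have "0 \<le> 1 - h (the_elem A)" "1 - h (the_elem A) \<le> 1" using h by auto
    then show "0 \<le> F A" "F A \<le> 1 - \<rho>" using \<rho> by (auto simp: F_def mult_left_le)
    then show "\<bar>F A\<bar> \<le> 1" using \<rho> by simp
  qed
  have QF: "0 \<le> Q F {x}" for x
  proof -
    have "Q F {x} = (\<Sum>\<^sub>\<infinity>y. p x y * (h y - h x) * - (1 - \<rho>)) - lam * of_bool (v0 = x) * F {x}"
      unfolding hole_generator_def
      by (simp add: F_def) (intro infsum_cong, auto simp: algebra_simps)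
    also have "lam * of_bool (v0 = x) * F {x} = 0"
      using h(3) by (auto simp: F_def)
    also have "(\<Sum>\<^sub>\<infinity>y. p x y * (h y - h x) * - (1 - \<rho>)) = rw_generator p h x * - (1 - \<rho>)"
      unfolding rw_generator_def by (rule infsum_cmult_left')
    finally show ?thesis using h(4)[of x] \<rho> by (simp add: mult_nonpos_nonpos)
  qed
  let ?w = "\<lambda>t. hole_prob (evolve (bernoulli_product \<rho>) t)"
  let ?u = "\<lambda>t A. ?w t A - F A"
  have "0 \<le> ?u t {x}"
  proof (rule hole_comparison[OF rates less_imp_le[OF lam_pos], where u = ?u and C = 2
        and n = 1 and t = t and A = "{x}" and u' = "\<lambda>t A. Q (?w t) A - 0"])
    fix t :: real and B :: "'v set" assume t: "0 \<le> t"
    note b = hole_prob_evolve_bounds[OF \<nu> t]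
    show "\<bar>?u t B\<bar> \<le> 2" using b(3)[of B] F(3)[of B] by linarith
    assume B: "finite B" "card B = 1"
    show "((\<lambda>t. ?u t B) has_real_derivative Q (?w t) B - 0) (at t within {0..})"
      by (intro DERIV_diff DERIV_const hole_prob_has_derivative \<nu> B t)
    have "Q (?u t) B = Q (?w t) B - Q F B"
      using b(3) F(3) by (intro hole_generator_diff[OF rates, where C = 1]) auto
    moreover obtain y where "B = {y}" using B(2) by (auto simp: card_1_singleton_iff)
    ultimately show "Q (?u t) B \<le> Q (?w t) B - 0" using QF[of y] by simp
  next
    show "0 \<le> ?u 0 B" if "finite B" "card B = 1" for B
      using that hole_prob_evolve_0[OF \<nu> that(1)] F(2)[of B] by (simp add: hole_prob_bernoulli)
  qed (use t in auto)
  then show ?thesis by (simp add: F_def)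
qed

end

end

section \<open>The limit is not a product measure\<close>

lemma irreducible_closed_set:
  assumes p: "irreducible_symmetric_rates p" and Z: "x \<in> Z" "\<And>x y. x \<in> Z \<Longrightarrow> 0 < p x y \<Longrightarrow> y \<in> Z"
  shows "y \<in> Z"
proof -
  have "y \<in> Z" if "x \<in> Z" "n_step p n x y \<noteq> 0" for n x
    using that
  proof (induction n arbitrary: x)
    case 0
    then show ?case by (auto split: if_splits)
  next
    case (Suc n)
    then obtain z where "p x z * n_step p n z y \<noteq> 0"
      using infsum_0[of UNIV "\<lambda>z. p x z * n_step p n z y"] by auto
    then have "0 < p x z" "n_step p n z y \<noteq> 0"
      using rates_nonneg[OF p, of x z] by (auto simp: less_le)
    with Suc show ?case using Z(2) by blast
  qed
  moreover obtain n where "0 < n_step p n x y" using rates_irreducible[OF p] by blast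
  ultimately show ?thesis using Z(1) by (metis less_irrefl)
qed

theorem proposition4p2:
  fixes p :: "'v::countable \<Rightarrow> 'v \<Rightarrow> real"
    and v0 :: 'v
    and P :: "'v \<Rightarrow> 'w measure"
    and X :: "real \<Rightarrow> 'w \<Rightarrow> 'v"
    and lam \<rho> :: real
    and K :: "real \<Rightarrow> ('v \<Rightarrow> bool) \<Rightarrow> ('v \<Rightarrow> bool) measure"
  assumes "irreducible_symmetric_rates p"
    and "random_walk p P X"
    and "transient_walk P X"
    and "0 < lam"
    and "sep_source_semigroup p lam v0 K"
    and "0 < \<rho>" and "\<rho> < 1"
  shows "\<exists>\<mu>. weak_limit (\<lambda>t. bernoulli_product \<rho> \<bind> K t) \<mu> \<and> \<not> is_product_measure \<mu>"
proof -
  interpret sep_source K p v0 lam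
    using assms by unfold_locales (auto simp: sep_source_semigroup_def)
  let ?\<nu> = "bernoulli_product \<rho> :: ('v \<Rightarrow> bool) measure"
  note \<nu> = bernoulli_law[OF assms(6,7)]
  obtain \<mu> where \<mu>: "weak_limit (evolve ?\<nu>) \<mu>"
    using weak_limit_exists_if_never_above_initial[OF \<nu> hole_prob_bernoulli_le[OF assms(6,7)]] by blast
  then have \<mu>_law: "prob_space \<mu>" "sets \<mu> = sets config_space"
    and conv: "\<And>f :: ('v \<Rightarrow> bool) \<Rightarrow> real. continuous_on UNIV f \<Longrightarrow>
      ((\<lambda>t. \<integral>\<eta>. f \<eta> \<partial>evolve ?\<nu> t) \<longlongrightarrow> (\<integral>\<eta>. f \<eta> \<partial>\<mu>)) at_top"
    unfolding weak_limit_def by blast+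
  have stationary: "Q (hole_prob \<mu>) A = 0" if "finite A" for A
    using weak_limit_stationary[OF \<nu> vacant_generates[OF that] \<mu>]
      integral_hole_generator[OF rates \<mu>_law that] by simp
  define g where "g x = hole_prob \<mu> {x}" for x
  have g_bounds: "0 \<le> g x" "g x \<le> 1" for x
    using hole_prob_bounds[OF \<mu>_law(1)] by (simp_all add: g_def)
  have g_harmonic: "(\<Sum>\<^sub>\<infinity>y. p x y * (g y - g x)) = lam * of_bool (v0 = x) * g x" for x
  proof -
    have "Q (hole_prob \<mu>) {x} = (\<Sum>\<^sub>\<infinity>y. p x y * (g y - g x)) - lam * of_bool (v0 = x) * g x"
      unfolding hole_generator_def by (simp add: g_def) (intro infsum_cong, auto)
    with stationary[of "{x}"] show ?thesis by simp
  qed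
  obtain h where h: "\<And>x. 0 \<le> h x" "\<And>x. h x \<le> 1" "h v0 = (1::real)"
      "\<And>x. rw_generator p h x \<le> 0" "\<exists>x. h x < 1"
    using transient_excessive_function[OF assms(2,3), of v0] by blast
  have g_ge: "(1 - \<rho>) * (1 - h x) \<le> g x" for x
    unfolding g_def
  proof (rule tendsto_lowerbound[OF conv])
    show "continuous_on UNIV (vacant {x})" by (rule vacant_continuous) simp
    show "\<forall>\<^sub>F t in at_top. (1 - \<rho>) * (1 - h x) \<le> hole_prob (evolve ?\<nu> t) {x}"
      using eventually_ge_at_top[of 0]
      by eventually_elim (rule hole_prob_bernoulli_ge[OF assms(6,7) h(1-4)])
  qed simp
  have "g v0 \<noteq> 0"
  proof
    assume "g v0 = 0"
    have "g x = 0" for x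
    proof -
      have "x \<in> {x. g x = 0}"
      proof (rule irreducible_closed_set[OF rates])
        show "v0 \<in> {x. g x = 0}" using \<open>g v0 = 0\<close> by simp
        fix x y assume x: "x \<in> {x. g x = 0}" and "0 < p x y"
        have "(\<Sum>\<^sub>\<infinity>z. p x z * g z) = 0" using g_harmonic[of x] x by simp
        moreover have "(\<lambda>z. p x z * g z) summable_on UNIV"
          using g_bounds by (intro rates_summable_bounded[OF rates, where C = 1]) simp
        ultimately have "p x y * g y = 0"
          using rates_nonneg[OF rates] g_bounds
          by (intro nonneg_infsum_le_0D[where A = UNIV and f = "\<lambda>z. p x z * g z"]) auto
        with \<open>0 < p x y\<close> show "y \<in> {x. g x = 0}" by simp
      qed
      then show ?thesis by simp
    qed
    moreover obtain x where "h x < 1" using h(5) by blast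
    ultimately show False using g_ge[of x] assms(7) by (simp add: mult_le_0_iff)
  qed
  have "\<not> is_product_measure \<mu>"
  proof
    assume "is_product_measure \<mu>"
    then obtain q :: "'v \<Rightarrow> bool pmf" where q: "\<mu> = Pi\<^sub>M UNIV (\<lambda>x. measure_pmf (q x))"
      unfolding is_product_measure_def by blast
    have W: "hole_prob \<mu> A = (\<Prod>x\<in>A. g x)" if "finite A" for A
      using that by (simp add: g_def q integral_vacant_product)
    have eq: "g x = g y" if "0 < p x y" for x y
    proof (cases "x = y")
      case False
      have "p x y * (g x - g y)\<^sup>2 = 0"
        using product_pair_identity[OF rates _ W False, of lam v0] g_bounds
          stationary[of "{x}"] stationary[of "{y}"] stationary[of "{x, y}"] by simp
      with that show ?thesis by simp
    qed simp
    have const: "g x = g v0" for x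
    proof -
      have "x \<in> {x. g x = g v0}"
        by (rule irreducible_closed_set[OF rates, of v0]) (use eq in auto)
      then show ?thesis by simp
    qed
    have "(\<Sum>\<^sub>\<infinity>y. p v0 y * (g y - g v0)) = 0"
      by (intro infsum_0) (metis const diff_self mult_zero_right)
    then have "lam * g v0 = 0" using g_harmonic[of v0] by simp
    with \<open>g v0 \<noteq> 0\<close> assms(4) show False by simp
  qed
  with \<mu> show ?thesis by blast
qed

end
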